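(* For each integer $k\ge 4$ let $J_k$ denote either the path $P_k$ or the cycle $C_k$. Let $n,m\ge 4$ be integers, with $J_n$ and $J_m$ chosen independently of each other. If $S$ is a power dominating set of $J_n\Box J_m$ that is not a dominating set, then $\operatorname{th}_{\rm pd}^{\times}(J_n\Box J_m;S)\ge \left\lceil\frac{nm}{4}\right\rceil$; and $\operatorname{th}_{\rm pd}^{\times}(J_n\Box J_m)=\gamma(J_n\Box J_m)$.
   Context: All graphs are finite, simple and undirected. $P_k$ and $C_k$ are the path and cycle on $k$ vertices. The Cartesian product $G\Box H$ has vertex set $V(G)\times V(H)$, with $(x_1,y_1)$ and $(x_2,y_2)$ adjacent if either $x_1=x_2$ and $y_1y_2\in E(H)$, or $y_1=y_2$ and $x_1x_2\in E(G)$. Let $G$ be a graph. A set $S\subseteq V(G)$ is dominating if $N[S]=V(G)$, where $N[S]$ is the closed neighborhood of $S$, and $\gamma(G)$ is the minimum size of a dominating set. For nonempty $S\subseteq V(G)$ define $P^{[0]}(S)=S$, $P^{[1]}(S)=N[S]$, and for $i\ge 1$, $P^{[i+1]}(S)=P^{[i]}(S)\cup\{w\in V(G)\setminus P^{[i]}(S): \exists u\in P^{[i]}(S),\ N(u)\setminus P^{[i]}(S)=\{w\}\}$. $S$ is a power dominating set if $P^{[t]}(S)=V(G)$ for some $t$. The power propagation time $\operatorname{pt}_{\rm pd}(G;S)$ is the least positive integer $t$ with $P^{[t]}(S)=V(G)$ (so it is at least $1$), and is $\infty$ if $S$ is not a power dominating set. Define $\operatorname{th}_{\rm pd}^{\times}(G;S)=|S|\operatorname{pt}_{\rm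 pd}(G;S)$ and $\operatorname{th}_{\rm pd}^{\times}(G)=\min_{\emptyset\ne S\subseteq V(G)}\operatorname{th}_{\rm pd}^{\times}(G;S)$. *)

theory Defs
  imports Complex_Main "HOL-Library.Extended_Nat"
begin

text \<open>A graph is a pair of a vertex set and a set of two-element vertex sets.\<close>

type_synonym 'a graph = "'a set \<times> 'a set set"

definition verts :: "'a graph \<Rightarrow> 'a set" where
  "verts G = fst G"

definition edges :: "'a graph \<Rightarrow> 'a set set" where
  "edges G = snd G"

definition simple_graph :: "'a graph \<Rightarrow> bool" where
  "simple_graph G \<longleftrightarrow>
     finite (verts G) \<and> (\<forall>e\<in>edges G. e \<subseteq> verts G \<and> card e = 2)"

definition path_graph :: "nat \<Rightarrow> nat graph" where
  "path_graph k = ({..<k}, {{i, Suc i} | i. Suc i < k})"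

text \<open>This is a cycle only for \<open>k \<ge> 3\<close>: it is a loop for \<open>k = 1\<close> and a single edge for
  \<open>k = 2\<close>.\<close>

definition cycle_graph :: "nat \<Rightarrow> nat graph" where
  "cycle_graph k = ({..<k}, {{i, Suc i mod k} | i. i < k})"

definition cart_prod :: "'a graph \<Rightarrow> 'b graph \<Rightarrow> ('a \<times> 'b) graph" (infixl "\<box>" 70) where
  "G \<box> H = (verts G \<times> verts H,
     {{(x1, y1), (x2, y2)} | x1 y1 x2 y2.
        (x1 \<in> verts G \<and> x1 = x2 \<and> {y1, y2} \<in> edges H) \<or>
        (y1 \<in> verts H \<and> y1 = y2 \<and> {x1, x2} \<in> edges G)})"

definition nbhd :: "'a graph \<Rightarrow> 'a \<Rightarrow> 'a set" where
  "nbhd G v = {w. {v, w} \<in> edges G}"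

definition closed_nbhd :: "'a graph \<Rightarrow> 'a set \<Rightarrow> 'a set" where
  "closed_nbhd G S = S \<union> (\<Union>v\<in>S. nbhd G v)"

definition dominating_set :: "'a graph \<Rightarrow> 'a set \<Rightarrow> bool" where
  "dominating_set G S \<longleftrightarrow> S \<subseteq> verts G \<and> closed_nbhd G S = verts G"

definition domination_number :: "'a graph \<Rightarrow> nat" where
  "domination_number G = Min (card ` {S. dominating_set G S})"

fun pd_closure :: "'a graph \<Rightarrow> 'a set \<Rightarrow> nat \<Rightarrow> 'a set" where
  "pd_closure G S 0 = S"
| "pd_closure G S (Suc 0) = closed_nbhd G S"
| "pd_closure G S (Suc (Suc i)) =
     (let P = pd_closure G S (Suc i)
      in P \<union> {w \<in> verts G - P. \<exists>u\<in>P. nbhd G u - P = {w}})"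

definition power_dominating_set :: "'a graph \<Rightarrow> 'a set \<Rightarrow> bool" where
  "power_dominating_set G S \<longleftrightarrow>
     S \<noteq> {} \<and> S \<subseteq> verts G \<and> (\<exists>t. pd_closure G S t = verts G)"

definition power_propagation_time :: "'a graph \<Rightarrow> 'a set \<Rightarrow> enat" where
  "power_propagation_time G S =
     (if power_dominating_set G S
      then enat (LEAST t. t > 0 \<and> pd_closure G S t = verts G) else \<infinity>)"

definition th_pd_set :: "'a graph \<Rightarrow> 'a set \<Rightarrow> enat" where
  "th_pd_set G S = enat (card S) * power_propagation_time G S"

definition th_pd :: "'a graph \<Rightarrow> enat" where
  "th_pd G = Min (th_pd_set G ` {S. S \<noteq> {} \<and> S \<subseteq> verts G})"

lemma simple_graph_path_graph: "simple_graph (path_graph k)"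
  by (auto simp: simple_graph_def path_graph_def verts_def edges_def card_insert_if)

lemma simple_graph_cycle_graph:
  assumes "k \<ge> 3" shows "simple_graph (cycle_graph k)"
  using assms
  by (auto simp: simple_graph_def cycle_graph_def verts_def edges_def card_insert_if mod_Suc
      split: if_splits)

lemma simple_graph_cart_prod:
  assumes "simple_graph G" "simple_graph H" shows "simple_graph (G \<box> H)"
  using assms
  by (fastforce simp: simple_graph_def cart_prod_def verts_def edges_def card_insert_if
      split: if_splits)

end

theory Submission
  imports Defs
begin

text \<open>Let \<open>B = N[S] - S\<close>, so \<open>|B| \<le> 4|S|\<close>. After the first round at most \<open>|B|\<close> vertices are
  forced in each round, since every forcer hands its role over to the vertex it forces. Local
  inspection shows that the four neighbours of a vertex of \<open>S\<close> cannot all be private to it and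
  force distinct vertices in round two; charging the vertices of \<open>B\<close> to \<open>S\<close> then yields
  \<open>|P\<^sup>[\<^sup>2\<^sup>]| \<le> 8|S|\<close>, and hence \<open>nm \<le> 4|S|t\<close> for \<open>t \<ge> 2\<close> rounds.

  Dominating sets of size \<open>\<lceil>nm/4\<rceil>\<close> are glued from finitely many explicit blocks, with a few
  exceptional sizes of products that have a path factor, where \<open>nm/4 + 1\<close> is needed. There equality
  \<open>nm = 4|S|t\<close> has to be excluded: it forces the edges leaving \<open>P\<^sup>[\<^sup>2\<^sup>]\<close> to form complete rows of
  parallel edges, which cannot reach the end of a path.\<close>

section \<open>Counting forced vertices\<close>

definition forced :: "'a graph \<Rightarrow> 'a set \<Rightarrow> 'a set" where
  "forced G X = {w \<in> verts G - X. \<exists>u\<in>X. nbhd G u - X = {w}}"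

text \<open>The vertices that may still force; their number is the potential that limits how much
  later rounds can add.\<close>

definition active :: "'a graph \<Rightarrow> 'a set \<Rightarrow> 'a set" where
  "active G X = {u \<in> X. \<not> nbhd G u \<subseteq> X}"

lemma pd_closure_step:
  "i \<ge> 1 \<Longrightarrow> pd_closure G S (Suc i) = pd_closure G S i \<union> forced G (pd_closure G S i)"
  by (cases i) (auto simp: forced_def Let_def)

lemma nbhd_sym: "v \<in> nbhd G u \<longleftrightarrow> u \<in> nbhd G v"
  by (simp add: nbhd_def insert_commute)

lemma nbhd_irrefl: "simple_graph G \<Longrightarrow> v \<notin> nbhd G v"
  by (fastforce simp: nbhd_def simple_graph_def)

lemma nbhd_subset: "simple_graph G \<Longrightarrow> nbhd G v \<subseteq> verts G"
  by (fastforce simp: nbhd_def simple_graph_def)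

lemma finite_verts: "simple_graph G \<Longrightarrow> finite (verts G)"
  by (simp add: simple_graph_def)

lemma finite_nbhd: "simple_graph G \<Longrightarrow> finite (nbhd G v)"
  by (meson finite_subset finite_verts nbhd_subset)

lemma closed_nbhd_subset: "simple_graph G \<Longrightarrow> S \<subseteq> verts G \<Longrightarrow> closed_nbhd G S \<subseteq> verts G"
  using nbhd_subset[of G] by (fastforce simp: closed_nbhd_def)

lemma pd_closure_subset:
  assumes "simple_graph G" "S \<subseteq> verts G"
  shows "pd_closure G S i \<subseteq> verts G"
proof (induction i)
  case (Suc i)
  then show ?case
    using closed_nbhd_subset[OF assms] by (cases i) (auto simp: Let_def)
qed (use assms in simp)

text \<open>One forcer is chosen for each forced vertex. A forcer has a single outside neighbour and
  so determines what it forces, which makes \<open>f\<close> injective on the chosen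
  forcers.\<close>

lemma forced_forcers:
  obtains A f where "A \<subseteq> active G X" "inj_on f A" "f ` A = forced G X"
    "\<And>u. u \<in> A \<Longrightarrow> nbhd G u - X = {f u}"
proof -
  obtain g where g: "\<And>w. w \<in> forced G X \<Longrightarrow> g w \<in> X \<and> nbhd G (g w) - X = {w}"
    unfolding forced_def by (atomize_elim, rule choice) blast
  define f where "f u = the_elem (nbhd G u - X)" for u
  have fg: "f (g w) = w" if "w \<in> forced G X" for w
    using g[OF that] by (simp add: f_def)
  show thesis
  proof
    show "g ` forced G X \<subseteq> active G X" using g by (fastforce simp: active_def)
    show "inj_on f (g ` forced G X)" using fg by (auto simp: inj_on_def)
    show "f ` g ` forced G X = forced G X" using fg by (force simp: image_image)
    show "nbhd G u - X = {f u}" if "u \<in> g ` forced G X" for u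
      using that fg g by (metis imageE)
  qed
qed

lemma active_subset: "active G X \<subseteq> X"
  by (auto simp: active_def)

lemma card_forced_le:
  assumes "finite X" shows "card (forced G X) \<le> card (active G X)"
proof -
  obtain A f where A: "A \<subseteq> active G X" "inj_on f A" "f ` A = forced G X"
    using forced_forcers[of G X] by metis
  moreover have "finite (active G X)" using assms active_subset finite_subset by metis
  ultimately show ?thesis by (metis card_image card_mono)
qed

text \<open>A vertex forced in this round takes over the activity of its forcer.\<close>

lemma card_active_step:
  assumes "finite X"
  shows "card (active G (X \<union> forced G X)) \<le> card (active G X)"
proof -
  obtain A f where A: "A \<subseteq> active G X" "inj_on f A" "f ` A = forced G X"
    "\<And>u. u \<in> A \<Longrightarrow> nbhd G u - X = {f u}"
    using forced_forcers[of G X] by metis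
  have fin: "finite (active G X)" using assms active_subset finite_subset by metis
  have "active G (X \<union> forced G X) \<subseteq> (active G X - A) \<union> f ` A"
    using A(3,4) by (fastforce simp: active_def)
  then have "card (active G (X \<union> forced G X)) \<le> card ((active G X - A) \<union> f ` A)"
    using fin A(1) by (intro card_mono) (auto intro: finite_subset)
  also have "\<dots> \<le> card (active G X - A) + card (f ` A)" by (rule card_Un_le)
  also have "card (f ` A) = card A" using A(2) by (rule card_image)
  also have "card (active G X - A) + card A = card (active G X)"
    using fin A(1) by (metis card_Diff_subset card_mono finite_subset le_add_diff_inverse2)
  finally show ?thesis .
qed

lemma finite_pd_closure:
  "simple_graph G \<Longrightarrow> S \<subseteq> verts G \<Longrightarrow> finite (pd_closure G S i)"
  by (meson finite_subset finite_verts pd_closure_subset)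

lemma card_active_antimono:
  assumes "simple_graph G" "S \<subseteq> verts G" "1 \<le> i" "i \<le> j"
  shows "card (active G (pd_closure G S j)) \<le> card (active G (pd_closure G S i))"
  using assms(4)
proof (induction j rule: dec_induct)
  case (step j)
  then show ?case
    using card_active_step[OF finite_pd_closure[OF assms(1,2)], of G j] pd_closure_step[of j G S] assms(3)
    by simp
qed simp

text \<open>A round adds at most one vertex per active vertex, and from the first round on the
  number of active vertices never grows.\<close>

lemma card_pd_closure_le:
  assumes "simple_graph G" "S \<subseteq> verts G" "1 \<le> i"
  shows "card (pd_closure G S (i + d))
    \<le> card (pd_closure G S i) + d * card (active G (pd_closure G S i))"
proof (induction d)
  case (Suc d)
  let ?P = "pd_closure G S (i + d)"
  have "card (pd_closure G S (i + Suc d)) \<le> card ?P + card (forced G ?P)"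
    using pd_closure_step[of "i + d" G S] assms(3) by (simp add: card_Un_le)
  also have "card (forced G ?P) \<le> card (active G ?P)"
    by (intro card_forced_le finite_pd_closure assms)
  also have "card (active G ?P) \<le> card (active G (pd_closure G S i))"
    by (intro card_active_antimono assms) simp
  finally show ?case using Suc by simp
qed simp

lemma active_closed_nbhd: "active G (closed_nbhd G S) \<subseteq> closed_nbhd G S - S"
  by (auto simp: active_def closed_nbhd_def)

text \<open>If as many vertices are forced as are active, the injective choice of forcers uses up
  all active vertices. Hence the edges leaving \<open>X\<close> form a matching; the two conclusions
  say so from either side.\<close>

lemma forced_saturated:
  assumes fin: "finite X" and le: "card (active G X) \<le> card (forced G X)"
  shows "\<lbrakk>u \<in> X; w \<in> nbhd G u - X; w' \<in> nbhd G u - X\<rbrakk> \<Longrightarrow> w = w'"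
    and "\<lbrakk>u \<in> X; u' \<in> X; w \<in> nbhd G u - X; w \<in> nbhd G u'\<rbrakk> \<Longrightarrow> u = u'"
proof -
  obtain A f where A: "A \<subseteq> active G X" "inj_on f A" "f ` A = forced G X"
    "\<And>u. u \<in> A \<Longrightarrow> nbhd G u - X = {f u}"
    using forced_forcers[of G X] by metis
  have "finite (active G X)" using fin active_subset finite_subset by metis
  then have eq: "active G X = A"
    using A(1) le card_image[OF A(2)] A(3) by (metis card_seteq)
  show "w = w'" if "u \<in> X" "w \<in> nbhd G u - X" "w' \<in> nbhd G u - X"
  proof -
    have "u \<in> A" using that eq by (auto simp: active_def)
    then show ?thesis using A(4) that by auto
  qed
  show "u = u'" if "u \<in> X" "u' \<in> X" "w \<in> nbhd G u - X" "w \<in> nbhd G u'"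
  proof -
    have "u \<in> A" "u' \<in> A" using that eq by (auto simp: active_def)
    moreover have "w \<in> nbhd G u' - X" using that by simp
    ultimately have "f u = w" "f u' = w" using A(4) that(3) by (metis singletonD)+
    with \<open>u \<in> A\<close> \<open>u' \<in> A\<close>
    show ?thesis using A(2) by (simp add: inj_on_def)
  qed
qed

text \<open>Each neighbour \<open>b\<close> of \<open>S\<close> weighs 1, or 2 if it forces, and splits its weight evenly among
  its neighbours in \<open>S\<close>; no element of \<open>S\<close> collects more than 7.\<close>

lemma boundary_weight:
  fixes G :: "'a graph"
  defines "B S \<equiv> closed_nbhd G S - S"
  assumes G: "simple_graph G" and S: "S \<subseteq> verts G" and A: "A \<subseteq> B S"
    and deg: "\<And>v. card (nbhd G v) \<le> 4"
    and loc: "\<And>s. \<lbrakk>s \<in> S; card (nbhd G s) = 4; nbhd G s \<inter> S = {};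
      \<And>b. b \<in> nbhd G s \<Longrightarrow> b \<in> A \<and> nbhd G b \<inter> S = {s}\<rbrakk> \<Longrightarrow> False"
  shows "card (B S) + card A \<le> 7 * card S"
    and "\<lbrakk>card (B S) + card A = 7 * card S; s \<in> S\<rbrakk>
      \<Longrightarrow> card (nbhd G s) = 4 \<and> nbhd G s \<inter> S = {}"
proof -
  define q :: "'a \<Rightarrow> real" where "q b = (1 + of_bool (b \<in> A)) / card (nbhd G b \<inter> S)" for b
  define c where "c s = (\<Sum>b\<in>nbhd G s \<inter> B S. q b)" for s
  have finS: "finite S" using S finite_verts[OF G] finite_subset by blast
  have finB: "finite (B S)"
    using closed_nbhd_subset[OF G S] finite_verts[OF G] finite_subset unfolding B_def by blast
  have pos: "card (nbhd G b \<inter> S) \<ge> 1" if "b \<in> B S" for b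
  proof -
    have "nbhd G b \<inter> S \<noteq> {}" using that nbhd_sym[of _ G b] by (auto simp: B_def closed_nbhd_def)
    then show ?thesis using finS by (simp add: Suc_le_eq card_gt_0_iff)
  qed
  have "(\<Sum>s\<in>S. c s) = (\<Sum>s\<in>S. \<Sum>b | b \<in> B S \<and> b \<in> nbhd G s. q b)"
    unfolding c_def by (intro sum.cong refl) auto
  also have "\<dots> = (\<Sum>b\<in>B S. \<Sum>s | s \<in> S \<and> b \<in> nbhd G s. q b)"
    by (rule sum.swap_restrict) (use finS finB in auto)
  also have "\<dots> = (\<Sum>b\<in>B S. 1 + of_bool (b \<in> A))"
  proof (intro sum.cong refl)
    fix b assume "b \<in> B S"
    moreover have "{s. s \<in> S \<and> b \<in> nbhd G s} = nbhd G b \<inter> S" using nbhd_sym by fast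
    ultimately show "(\<Sum>s | s \<in> S \<and> b \<in> nbhd G s. q b) = 1 + of_bool (b \<in> A)"
      using pos[of b] by (simp add: q_def)
  qed
  also have "\<dots> = card (B S) + card A"
    using finB A by (simp add: sum.distrib Int_absorb1 of_bool_def sum.If_cases)
  finally have total: "(\<Sum>s\<in>S. c s) = real (card (B S) + card A)" .
  have q2: "q b \<le> 2" if "b \<in> B S" for b
    using pos[OF that] by (auto simp: q_def divide_simps)
  have q1: "q b \<le> 1" if "b \<in> B S" "\<not> (b \<in> A \<and> card (nbhd G b \<inter> S) = 1)" for b
    using pos[OF that(1)] that(2) by (auto simp: q_def divide_simps)
  have c6: "c s \<le> 6" if "card (nbhd G s \<inter> B S) \<le> 3" for s
  proof -
    have "c s \<le> (\<Sum>b\<in>nbhd G s \<inter> B S. 2)" unfolding c_def by (intro sum_mono q2) auto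
    also have "\<dots> \<le> 6" using that by simp
    finally show ?thesis .
  qed
  have full: "nbhd G s \<subseteq> B S \<and> card (nbhd G s) = 4"
    if "\<not> card (nbhd G s \<inter> B S) \<le> 3" for s
  proof -
    have *: "card (nbhd G s \<inter> B S) \<le> card (nbhd G s)"
      by (intro card_mono finite_nbhd G) auto
    then have "card (nbhd G s) = 4" "card (nbhd G s \<inter> B S) = 4"
      using that deg[of s] by auto
    then show ?thesis using finite_nbhd[OF G, of s] by (metis card_subset_eq inf.absorb_iff1 inf_le1)
  qed
  have c7: "c s \<le> 7" if s: "s \<in> S" for s
  proof (cases "card (nbhd G s \<inter> B S) \<le> 3")
    case True
    then show ?thesis using c6[of s] by simp
  next
    case False
    have sub: "nbhd G s \<subseteq> B S" "card (nbhd G s) = 4" using full[OF False] by auto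
    then have "nbhd G s \<inter> S = {}" by (auto simp: B_def)
    \<comment> \<open>By \<open>loc\<close> some neighbour of \<open>s\<close> is not a forcer
      private to \<open>s\<close>. Its share is at most 1, and with at most 2 from each of the other
      three the total is at most 7.\<close>
    then obtain b where b: "b \<in> nbhd G s" "\<not> (b \<in> A \<and> nbhd G b \<inter> S = {s})"
      using loc[OF s sub(2)] by blast
    have "s \<in> nbhd G b \<inter> S" using b(1) s nbhd_sym by fast
    then have "\<not> (b \<in> A \<and> card (nbhd G b \<inter> S) = 1)"
      using b(2) by (metis card_1_singletonE singletonD)
    then have "q b \<le> 1" using q1 b(1) sub(1) by blast
    moreover have "sum q (nbhd G s - {b}) \<le> (\<Sum>b\<in>nbhd G s - {b}. 2)"
      using sub(1) by (intro sum_mono q2) auto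
    moreover have "c s = q b + sum q (nbhd G s - {b})"
      unfolding c_def using sub(1) b(1) finite_nbhd[OF G]
      by (simp add: Int_absorb2 sum.remove)
    ultimately show ?thesis using b(1) sub(2) finite_nbhd[OF G, of s] by simp
  qed
  have "(\<Sum>s\<in>S. c s) \<le> (\<Sum>s\<in>S. 7)" by (intro sum_mono c7)
  then show "card (B S) + card A \<le> 7 * card S" using total by simp
  show "card (nbhd G s) = 4 \<and> nbhd G s \<inter> S = {}"
    if eq: "card (B S) + card A = 7 * card S" and s: "s \<in> S"
  proof -
    \<comment> \<open>Equality in total forces each element to collect exactly 7, more than three
      neighbours outside \<open>S\<close> can supply.\<close>
    have "(\<Sum>s\<in>S. c s) = (\<Sum>s\<in>S. 7)" using total eq by simp
    then have "c s = 7" using sum_mono_inv[of c S "\<lambda>_. 7"] c7 s finS by auto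
    then have "\<not> card (nbhd G s \<inter> B S) \<le> 3" using c6[of s] by auto
    then show ?thesis using full[of s] by (auto simp: B_def)
  qed
qed

section \<open>Products of graphs of maximum degree two\<close>

lemma mem_nbhd_cart_prod:
  "(x', y') \<in> nbhd (G \<box> H) (x, y) \<longleftrightarrow>
     x \<in> verts G \<and> x' = x \<and> y' \<in> nbhd H y \<or> y \<in> verts H \<and> y' = y \<and> x' \<in> nbhd G x"
proof -
  have "(x', y') \<in> nbhd (G \<box> H) (x, y) \<longleftrightarrow> {(x, y), (x', y')} \<in> snd (G \<box> H)"
    by (simp add: nbhd_def edges_def)
  also have "\<dots> \<longleftrightarrow> (x \<in> verts G \<and> x' = x \<and> {y, y'} \<in> edges H
      \<or> y \<in> verts H \<and> y' = y \<and> {x, x'} \<in> edges G)"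
    unfolding cart_prod_def by (fastforce simp: doubleton_eq_iff insert_commute)
  finally show ?thesis by (simp add: nbhd_def)
qed

lemma verts_cart_prod: "verts (G \<box> H) = verts G \<times> verts H"
  by (simp add: verts_def cart_prod_def)

lemma nbhd_cart_prod:
  "x \<in> verts G \<Longrightarrow> y \<in> verts H \<Longrightarrow>
    nbhd (G \<box> H) (x, y) = (\<lambda>x'. (x', y)) ` nbhd G x \<union> Pair x ` nbhd H y"
  by (auto simp: mem_nbhd_cart_prod)

lemma card_nbhd_cart_prod:
  assumes "simple_graph G" "simple_graph H" "x \<in> verts G" "y \<in> verts H"
  shows "card (nbhd (G \<box> H) (x, y)) = card (nbhd G x) + card (nbhd H y)"
proof -
  have "(\<lambda>x'. (x', y)) ` nbhd G x \<inter> Pair x ` nbhd H y = {}"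
    using nbhd_irrefl[OF assms(1)] by auto
  then show ?thesis
    using assms finite_nbhd[OF assms(1)] finite_nbhd[OF assms(2)]
    by (simp add: nbhd_cart_prod card_Un_disjoint card_image inj_on_def)
qed

text \<open>How maximum degree two gets used: besides a given neighbour there is at most one
  other.\<close>

lemma card_le_2:
  assumes "finite A" "card A \<le> 2" "a \<in> A" "b \<in> A" "c \<in> A" "a \<noteq> b" "a \<noteq> c"
  shows "b = c"
proof (rule ccontr)
  assume "b \<noteq> c"
  then have "card {a, b, c} = 3" using assms by simp
  moreover have "card {a, b, c} \<le> card A" using assms by (intro card_mono) auto
  ultimately show False using assms(2) by simp
qed

text \<open>Maximum degree two is what paths and cycles share, so all choices of factors are treated
  at once; path ends and connectedness enter later as separate hypotheses.\<close>

locale chain_product =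
  fixes J :: "'a graph" and J' :: "'b graph"
  assumes simple: "simple_graph J" "simple_graph J'"
    and deg: "card (nbhd J x) \<le> 2" "card (nbhd J' y) \<le> 2"
begin

abbreviation "G \<equiv> J \<box> J'"

lemma simple_prod: "simple_graph G"
  using simple by (rule simple_graph_cart_prod)

lemma deg_prod: "card (nbhd G v) \<le> 4"
proof (cases "v \<in> verts G")
  case True
  then obtain x y where "v = (x, y)" "x \<in> verts J" "y \<in> verts J'" by (auto simp: verts_cart_prod)
  then show ?thesis using card_nbhd_cart_prod[OF simple] deg(1)[of x] deg(2)[of y] by simp
next
  case False
  then have "nbhd G v = {}" using nbhd_subset[OF simple_prod] nbhd_sym by fast
  then show ?thesis by simp
qed

lemma deg4_factors:
  assumes "card (nbhd G (x, y)) = 4"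
  shows "x \<in> verts J" "y \<in> verts J'" "card (nbhd J x) = 2" "card (nbhd J' y) = 2"
proof -
  have "nbhd G (x, y) \<noteq> {}" using assms by auto
  then have "(x, y) \<in> verts G" using nbhd_subset[OF simple_prod] nbhd_sym by fast
  then show v: "x \<in> verts J" "y \<in> verts J'" by (auto simp: verts_cart_prod)
  show "card (nbhd J x) = 2" "card (nbhd J' y) = 2"
    using assms card_nbhd_cart_prod[OF simple v] deg(1)[of x] deg(2)[of y] by auto
qed

text \<open>If all four neighbours of \<open>s\<close> were private forcers, the diagonal vertices
  next to \<open>s\<close> would have to be dominated, as two forcers would otherwise compete for
  one of them. A vertex of \<open>S\<close> dominating a diagonal then spoils one of the two forcers
  beside it.\<close>

lemma not_all_nbrs_force:
  assumes s: "s \<in> S" "card (nbhd G s) = 4" "nbhd G s \<inter> S = {}"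
    and b: "\<And>b. b \<in> nbhd G s \<Longrightarrow> b \<in> A \<and> nbhd G b \<inter> S = {s}"
    and inj: "inj_on f A" and f: "\<And>u. u \<in> A \<Longrightarrow> nbhd G u - closed_nbhd G S = {f u}"
  shows False
proof -
  let ?P = "closed_nbhd G S"
  obtain x y where xy: "s = (x, y)" by fastforce
  have v: "x \<in> verts J" "y \<in> verts J'" and d: "card (nbhd J x) = 2" "card (nbhd J' y) = 2"
    using deg4_factors s(2) xy by blast+
  obtain x1 y1 where x1: "x1 \<in> nbhd J x" and y1: "y1 \<in> nbhd J' y"
    using d by (metis all_not_in_conv card.empty zero_neq_numeral)
  have v1: "x1 \<in> verts J" "y1 \<in> verts J'"
    using x1 y1 nbhd_subset[OF simple(1)] nbhd_subset[OF simple(2)] by blast+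
  have ne: "x1 \<noteq> x" "y1 \<noteq> y"
    using x1 y1 nbhd_irrefl[OF simple(1)] nbhd_irrefl[OF simple(2)] by blast+
  have nb: "(x', y) \<in> nbhd G s" "(x, y') \<in> nbhd G s" if "x' \<in> nbhd J x" "y' \<in> nbhd J' y" for x' y'
    using that v xy by (auto simp: mem_nbhd_cart_prod)
  have SP: "u \<in> ?P" if "u \<in> S \<or> u \<in> nbhd G v" "v \<in> S" for u v
    using that by (auto simp: closed_nbhd_def)
  \<comment> \<open>An undominated diagonal would be the vertex forced by both neighbours of
    \<open>s\<close> adjacent to it, against injectivity of \<open>f\<close>.\<close>
  have diag: "(x', y') \<in> ?P" if "x' \<in> nbhd J x" "y' \<in> nbhd J' y" for x' y'
  proof (rule ccontr)
    assume n: "(x', y') \<notin> ?P"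
    have v': "x' \<in> verts J" "y' \<in> verts J'"
      using that nbhd_subset[OF simple(1)] nbhd_subset[OF simple(2)] by blast+
    have "(x', y') \<in> nbhd G (x', y) - ?P" "(x', y') \<in> nbhd G (x, y') - ?P"
      using n that v' by (auto simp: mem_nbhd_cart_prod)
    moreover have A: "(x', y) \<in> A" "(x, y') \<in> A" using b nb that by blast+
    ultimately have "f (x', y) = f (x, y')" using f by (metis singletonD)
    then have "x' = x" using inj A by (auto simp: inj_on_def)
    then show False using that nbhd_irrefl[OF simple(1)] by blast
  qed
  \<comment> \<open>The rest takes place in one quadrant: \<open>(x1, y)\<close> and
    \<open>(x, y1)\<close> act as the eastern and northern neighbours of \<open>s\<close>.\<close>
  have E: "(x1, y) \<in> A" "(x1, y) \<notin> S" and N: "(x, y1) \<in> A" "(x, y1) \<notin> S"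
    using b nb x1 y1 s(3) by blast+
  have "f (x1, y) \<in> nbhd G (x1, y)" "f (x1, y) \<notin> ?P" using f[OF E(1)] by blast+
  moreover obtain p q where pq: "f (x1, y) = (p, q)" by fastforce
  ultimately have "(p, q) \<in> nbhd G (x1, y)" "(p, q) \<notin> ?P" by simp_all
  \<comment> \<open>The diagonals being dominated, the eastern neighbour can only force straight on,
    to \<open>(p, y)\<close>.\<close>
  then have "q = y" "p \<in> nbhd J x1" and far: "(p, y) \<notin> ?P"
    using diag[OF x1, of q] unfolding mem_nbhd_cart_prod by metis+
  have "p \<noteq> x" using far xy s(1) by (auto simp: closed_nbhd_def)
  have "(x1, y1) \<in> nbhd G (x1, y)" using y1 v1 by (simp add: mem_nbhd_cart_prod)
  moreover have "nbhd G (x1, y) \<inter> S = {s}" using b[OF nb(1)[OF x1 y1]] by blast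
  moreover have "(x1, y1) \<noteq> s" using ne xy by simp
  ultimately have "(x1, y1) \<notin> S" by blast
  then obtain c e where ce: "(c, e) \<in> S" "(x1, y1) \<in> nbhd G (c, e)"
    using diag[OF x1 y1] by (auto simp: closed_nbhd_def)
  \<comment> \<open>A dominator of the diagonal in its own row would sit at \<open>(p, y1)\<close>,
    as \<open>(x, y1)\<close> is not in \<open>S\<close>, and would dominate \<open>(p, y)\<close>.
    So it lies in the column of the diagonal.\<close>
  have "c = x1 \<and> e \<in> nbhd J' y1"
  proof (rule ccontr)
    assume "\<not> ?thesis"
    then have "e = y1" "c \<in> nbhd J x1"
      using ce(2) nbhd_sym[of _ J] nbhd_sym[of _ J'] by (auto simp: mem_nbhd_cart_prod)
    moreover have "x \<in> nbhd J x1" using x1 nbhd_sym by fast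
    moreover have "c \<noteq> x" using ce(1) N(2) \<open>e = y1\<close> by auto
    ultimately have "c = p" using card_le_2[OF finite_nbhd[OF simple(1)] deg(1)] \<open>p \<noteq> x\<close> \<open>p \<in> nbhd J x1\<close>
      by metis
    then have "(p, y) \<in> nbhd G (c, e)" using \<open>e = y1\<close> y1 nbhd_sym[of _ J'] \<open>p \<in> nbhd J x1\<close>
        nbhd_subset[OF simple(1)] by (auto simp: mem_nbhd_cart_prod)
    then show False using far SP ce(1) by blast
  qed
  then have e: "c = x1" "e \<in> nbhd J' y1" by auto
  have "e \<noteq> y" using E(2) ce(1) e(1) by auto
  have ev: "e \<in> verts J'" using e(2) nbhd_subset[OF simple(2)] by blast
  \<comment> \<open>\<open>(x, e)\<close> lies straight north of \<open>(x, y1)\<close>. Being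
    dominated from \<open>(x1, e)\<close>, it leaves the northern neighbour nothing to
    force.\<close>
  have "(x, e) \<in> ?P"
    using ce(1) e(1) x1 ev nbhd_sym[of _ J] by (intro SP[of _ "(c, e)"]) (auto simp: mem_nbhd_cart_prod)
  moreover have "g = y \<or> g = e" if "g \<in> nbhd J' y1" for g
    using card_le_2[OF finite_nbhd[OF simple(2)] deg(2), of g y1 y e] that y1 nbhd_sym e(2) \<open>e \<noteq> y\<close>
    by metis
  moreover have "(x, y) \<in> ?P" using xy s(1) SP by blast
  ultimately have "v \<in> ?P" if "v \<in> nbhd G (x, y1)" for v
    using diag[OF _ y1] that by (cases v) (metis mem_nbhd_cart_prod)
  then show False using f[OF N(1)] by blast
qed

text \<open>The second closure consists of \<open>S\<close>, its outer neighbours and one vertex per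
  forcer in \<open>A\<close>. \<open>boundary_weight\<close> bounds the last two together by 7 per
  element of \<open>S\<close>, and its equality case carries over.\<close>

lemma two_rounds:
  assumes S: "S \<subseteq> verts G"
  defines "P \<equiv> closed_nbhd G S"
  shows "card (P \<union> forced G P) \<le> 8 * card S"
    and "\<lbrakk>card (P \<union> forced G P) = 8 * card S; s \<in> S\<rbrakk>
      \<Longrightarrow> card (nbhd G s) = 4 \<and> nbhd G s \<inter> S = {}"
proof -
  obtain A f where A: "A \<subseteq> active G P" "inj_on f A" "f ` A = forced G P"
    "\<And>u. u \<in> A \<Longrightarrow> nbhd G u - P = {f u}"
    using forced_forcers[of G P] by metis
  have AB: "A \<subseteq> closed_nbhd G S - S" using A(1) active_closed_nbhd P_def by fast
  have loc: "False" if "s \<in> S" "card (nbhd G s) = 4" "nbhd G s \<inter> S = {}"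
      "\<And>b. b \<in> nbhd G s \<Longrightarrow> b \<in> A \<and> nbhd G b \<inter> S = {s}" for s
    using not_all_nbrs_force[OF that A(2)] A(4) P_def by blast
  have "finite S" using S finite_verts[OF simple_prod] finite_subset by blast
  have fin: "finite P" unfolding P_def
    using finite_subset[OF closed_nbhd_subset[OF simple_prod S] finite_verts[OF simple_prod]] .
  have "S \<subseteq> P" by (auto simp: P_def closed_nbhd_def)
  then have "card P = card S + card (P - S)"
    using fin by (metis \<open>finite S\<close> card_Diff_subset card_mono le_add_diff_inverse)
  moreover have "card (forced G P) = card A" using A(2,3) card_image by metis
  moreover have "card (P \<union> forced G P) = card P + card (forced G P)"
    using fin finite_verts[OF simple_prod] by (intro card_Un_disjoint) (auto simp: forced_def)
  ultimately have eq: "card (P \<union> forced G P) = card S + (card (closed_nbhd G S - S) + card A)"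
    by (simp add: P_def)
  have "card (closed_nbhd G S - S) + card A \<le> 7 * card S"
    using boundary_weight(1)[OF simple_prod S AB deg_prod] loc by blast
  then show "card (P \<union> forced G P) \<le> 8 * card S" using eq by simp
  show "card (nbhd G s) = 4 \<and> nbhd G s \<inter> S = {}"
    if "card (P \<union> forced G P) = 8 * card S" "s \<in> S"
    using boundary_weight(2)[OF simple_prod S AB deg_prod _ _ that(2)] loc that(1) eq by force
qed

lemma card_active_le:
  assumes S: "S \<subseteq> verts G"
  shows "card (active G (closed_nbhd G S)) \<le> 4 * card S"
proof -
  have fin: "finite (closed_nbhd G S)" "finite S"
    using finite_subset[OF closed_nbhd_subset[OF simple_prod S]] finite_subset[OF S]
      finite_verts[OF simple_prod] by auto
  have "active G (closed_nbhd G S) \<subseteq> (\<Union>s\<in>S. nbhd G s)"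
    using active_closed_nbhd[of G S] by (auto simp: closed_nbhd_def)
  then have "card (active G (closed_nbhd G S)) \<le> card (\<Union>s\<in>S. nbhd G s)"
    using fin finite_nbhd[OF simple_prod] by (intro card_mono) auto
  also have "\<dots> \<le> (\<Sum>s\<in>S. card (nbhd G s))" by (rule card_UN_le[OF fin(2)])
  also have "\<dots> \<le> (\<Sum>s\<in>S. 4)" by (intro sum_mono deg_prod)
  finally show ?thesis by simp
qed

section \<open>Lower bound for a given number of rounds\<close>

abbreviation "P2 S \<equiv> pd_closure G S 2"

lemma P2_eq: "P2 S = closed_nbhd G S \<union> forced G (closed_nbhd G S)"
  using pd_closure_step[of 1 G S] by (simp add: numeral_2_eq_2)

text \<open>Two rounds account for at most \<open>8 * card S\<close> vertices and each of the
  remaining \<open>t - 2\<close> for at most \<open>4 * card S\<close>, together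
  \<open>4 * (card S * t)\<close>. In the equality case these estimates are sharp.\<close>

lemma card_closure_le:
  assumes S: "S \<subseteq> verts G" and t: "t \<ge> 2" "pd_closure G S t = verts G"
  shows "card (verts G) \<le> 4 * (card S * t)"
    and "\<lbrakk>card (verts G) = 4 * (card S * t); s \<in> S\<rbrakk>
      \<Longrightarrow> card (nbhd G s) = 4 \<and> nbhd G s \<inter> S = {}"
    and "card (verts G) = 4 * (card S * t) \<Longrightarrow> card (P2 S) = 8 * card S"
    and "\<lbrakk>card (verts G) = 4 * (card S * t); t \<ge> 3\<rbrakk>
      \<Longrightarrow> card (active G (P2 S)) \<le> card (forced G (P2 S))"
proof -
  have a2: "card (active G (P2 S)) \<le> 4 * card S"
    using card_active_antimono[OF simple_prod S, of 1 2] card_active_le[OF S] by simp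
  have p2: "card (P2 S) \<le> 8 * card S" using two_rounds(1)[OF S] P2_eq by simp
  have "card (verts G) \<le> card (P2 S) + (t - 2) * card (active G (P2 S))"
    using card_pd_closure_le[OF simple_prod S, of 2 "t - 2"] t
    by (metis le_add_diff_inverse one_le_numeral)
  also have "\<dots> \<le> card (P2 S) + (t - 2) * (4 * card S)"
    using a2 mult_le_mono2 by auto
  finally have le: "card (verts G) \<le> card (P2 S) + (t - 2) * (4 * card S)" .
  have t4: "8 * card S + (t - 2) * (4 * card S) = 4 * (card S * t)"
  proof -
    obtain d where "t = 2 + d" using t(1) le_Suc_ex by blast
    then show ?thesis by (simp add: algebra_simps)
  qed
  show "card (verts G) \<le> 4 * (card S * t)" using le p2 t4 by simp
  show p2': "card (P2 S) = 8 * card S" if "card (verts G) = 4 * (card S * t)"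
    using le p2 t4 that by simp
  show "card (nbhd G s) = 4 \<and> nbhd G s \<inter> S = {}"
    if "card (verts G) = 4 * (card S * t)" "s \<in> S"
    using two_rounds(2)[OF S] P2_eq p2' that by simp
  show "card (active G (P2 S)) \<le> card (forced G (P2 S))"
    if eq: "card (verts G) = 4 * (card S * t)" and t3: "t \<ge> 3"
  proof -
    have p3: "pd_closure G S 3 = P2 S \<union> forced G (P2 S)"
      using pd_closure_step[of 2 G S] by (simp add: eval_nat_numeral)
    \<comment> \<open>The third round is split off: equality makes it force at least
      \<open>4 * card S\<close> vertices, no fewer than there are active ones.\<close>
    have "card (verts G) \<le> card (pd_closure G S 3) + (t - 3) * card (active G (pd_closure G S 3))"
      using card_pd_closure_le[OF simple_prod S, of 3 "t - 3"] t t3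
      by (metis le_add_diff_inverse one_le_numeral)
    also have "(t - 3) * card (active G (pd_closure G S 3)) \<le> (t - 3) * (4 * card S)"
      using card_active_antimono[OF simple_prod S, of 2 3] a2 by (intro mult_le_mono2) simp
    also have "card (pd_closure G S 3) \<le> card (P2 S) + card (forced G (P2 S))"
      using p3 card_Un_le by simp
    finally have "4 * (card S * t) \<le> 8 * card S + card (forced G (P2 S)) + (t - 3) * (4 * card S)"
      using eq p2'[OF eq] by simp
    moreover have "4 * (card S * t) = 12 * card S + (t - 3) * (4 * card S)"
    proof -
      obtain d where "t = 3 + d" using t3 le_Suc_ex by blast
      then show ?thesis by (simp add: algebra_simps)
    qed
    ultimately show ?thesis using a2 by simp
  qed
qed

end

section \<open>Configurations attaining the bound\<close>

lemma verts_swap: "verts (H \<box> G) = prod.swap ` verts (G \<box> H)"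
  by (auto simp: verts_cart_prod)

lemma nbhd_swap: "nbhd (H \<box> G) (prod.swap v) = prod.swap ` nbhd (G \<box> H) v"
proof -
  have "w \<in> nbhd (H \<box> G) (prod.swap v) \<longleftrightarrow> prod.swap w \<in> nbhd (G \<box> H) v" for w
    by (cases v; cases w) (auto simp: mem_nbhd_cart_prod)
  then show ?thesis by (force simp: image_iff)
qed

lemma closed_nbhd_swap:
  "closed_nbhd (H \<box> G) (prod.swap ` S) = prod.swap ` closed_nbhd (G \<box> H) S"
  by (simp add: closed_nbhd_def nbhd_swap image_Un image_UN)

lemma forced_swap: "forced (H \<box> G) (prod.swap ` X) = prod.swap ` forced (G \<box> H) X"
proof -
  have "nbhd (H \<box> G) (prod.swap u) - prod.swap ` X = {prod.swap w} \<longleftrightarrow> nbhd (G \<box> H) u - X = {w}"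
    for u w
    by (metis (no_types) image_insert image_empty image_set_diff inj_image_eq_iff inj_swap nbhd_swap)
  then show ?thesis by (fastforce simp: forced_def verts_swap[of H G])
qed

lemma pd_closure_swap:
  "pd_closure (H \<box> G) (prod.swap ` S) i = prod.swap ` pd_closure (G \<box> H) S i"
proof (induction i)
  case (Suc i)
  then show ?case
    using pd_closure_step[of i "H \<box> G" "prod.swap ` S"] pd_closure_step[of i "G \<box> H" S]
    by (cases "i = 0") (simp_all add: closed_nbhd_swap forced_swap image_Un)
qed simp

lemma swap_image_eq: "prod.swap ` A = prod.swap ` B \<longleftrightarrow> A = B"
  by (metis inj_image_eq_iff inj_swap)

lemma card_swap: "card (prod.swap ` A) = card A"
  by (simp add: card_image)

lemma swap_subset_verts: "prod.swap ` S \<subseteq> verts (H \<box> G) \<longleftrightarrow> S \<subseteq> verts (G \<box> H)"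
  by (auto simp: verts_cart_prod)

lemma dominating_set_swap: "dominating_set (H \<box> G) (prod.swap ` S) \<longleftrightarrow> dominating_set (G \<box> H) S"
  unfolding dominating_set_def
  by (simp only: closed_nbhd_swap verts_swap[of H G] swap_image_eq
      swap_subset_verts[of S H G, unfolded verts_swap[of H G]])

text \<open>Phrased by neighbour-closed sets instead of walks, so that a property handed along edges
  spreads to all vertices in one step.\<close>

definition connected_graph :: "'a graph \<Rightarrow> bool" where
  "connected_graph G \<longleftrightarrow>
     (\<forall>X \<subseteq> verts G. X \<noteq> {} \<longrightarrow> (\<forall>x\<in>X. nbhd G x \<subseteq> X) \<longrightarrow> X = verts G)"

lemma connected_graphD:
  "\<lbrakk>connected_graph G; x \<in> verts G; Q x; \<And>u v. \<lbrakk>u \<in> verts G; Q u; v \<in> nbhd G u\<rbrakk> \<Longrightarrow> v \<in> verts G \<and> Q v;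
    y \<in> verts G\<rbrakk> \<Longrightarrow> Q y"
  unfolding connected_graph_def by (drule spec[of _ "{v \<in> verts G. Q v}"]) blast

section \<open>The equality case at the ends of paths\<close>

context chain_product
begin

lemma chain_product_swap: "chain_product J' J"
  using simple deg by unfold_locales

text \<open>The equality case of \<open>card_closure_le\<close>: a run of at least two rounds that
  meets the bound exactly.\<close>

definition tight :: "('a \<times> 'b) set \<Rightarrow> nat \<Rightarrow> bool" where
  "tight S t \<longleftrightarrow> S \<subseteq> verts G \<and> t \<ge> 2 \<and> pd_closure G S t = verts G
     \<and> card (verts G) = 4 * (card S * t)"

lemma tightD:
  assumes "tight S t" "s \<in> S"
  shows "card (nbhd G s) = 4" "nbhd G s \<inter> S = {}"
  using assms card_closure_le(2)[of S t s] by (auto simp: tight_def)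

lemma P1_iff: "v \<in> closed_nbhd G S \<longleftrightarrow> v \<in> S \<or> (\<exists>s\<in>S. v \<in> nbhd G s)"
  by (auto simp: closed_nbhd_def)

lemma end_not_in:
  assumes "tight S t" "nbhd J a = {a1}"
  shows "(a, d) \<notin> S"
  using tightD(1)[OF assms(1)] deg4_factors(3)[of a d] assms(2) by auto

text \<open>In a tight configuration the vertices of \<open>S\<close> have degree four, so
  \<open>S\<close> avoids the fibre over an end of \<open>J\<close>; only the inward neighbour can
  dominate there.\<close>

lemma end_dominated:
  assumes T: "tight S t" and a: "nbhd J a = {a1}" and d: "(a, d) \<in> closed_nbhd G S"
  shows "(a1, d) \<in> S"
proof -
  obtain p q where "(p, q) \<in> S" "(a, d) \<in> nbhd G (p, q)"
    using d end_not_in[OF T a] P1_iff by auto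
  then show ?thesis
    using end_not_in[OF T a] a nbhd_sym[of a J p] by (auto simp: mem_nbhd_cart_prod)
qed

lemma end_dominated':
  assumes T: "tight S t" and b: "nbhd J' b = {b1}" and d: "(d, b) \<in> closed_nbhd G S"
  shows "(d, b1) \<in> S"
proof -
  have n: "(e, b) \<notin> S" for e using tightD(1)[OF T] deg4_factors(4)[of e b] b by auto
  obtain p q where "(p, q) \<in> S" "(d, b) \<in> nbhd G (p, q)"
    using d n P1_iff by auto
  then show ?thesis
    using n b nbhd_sym[of b J' q] by (auto simp: mem_nbhd_cart_prod)
qed

text \<open>A vertex over an end is dominated or forced from inside. A forcer \<open>(a, q)\<close>
  within the end fibre is dominated by \<open>(a1, q)\<close> and its other neighbour in the fibre
  by \<open>(a1, e)\<close>; these two would be adjacent, but \<open>S\<close> is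
  independent.\<close>

lemma end_observed:
  assumes T: "tight S t" and a: "nbhd J a = {a1}" and c: "(a, c) \<in> P2 S"
  shows "(a1, c) \<in> S \<or> (a1, c) \<in> closed_nbhd G S \<and> nbhd G (a1, c) - closed_nbhd G S \<subseteq> {(a, c)}"
proof (cases "(a, c) \<in> closed_nbhd G S")
  case True
  then show ?thesis using end_dominated[OF T a] by blast
next
  case False
  then obtain p q where u: "(p, q) \<in> closed_nbhd G S" "nbhd G (p, q) - closed_nbhd G S = {(a, c)}"
    using c unfolding P2_eq forced_def by auto
  then have "(a, c) \<in> nbhd G (p, q)" by blast
  then consider "p = a" "c \<in> nbhd J' q" | "p = a1" "q = c"
    using a nbhd_sym[of a J p] by (auto simp: mem_nbhd_cart_prod)
  then show ?thesis
  proof cases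
    case 1
    then have s: "(a1, q) \<in> S" using end_dominated[OF T a] u(1) by blast
    then have "card (nbhd J' q) = 2" using tightD(1)[OF T] deg4_factors(4) by blast
    then have "\<not> nbhd J' q \<subseteq> {c}" using card_mono[of "{c}" "nbhd J' q"] by auto
    then obtain e where e: "e \<in> nbhd J' q" "e \<noteq> c" by blast
    have v: "a \<in> verts J" "a1 \<in> verts J"
      using a nbhd_sym[of a J a1] nbhd_subset[OF simple(1)] by blast+
    then have "(a, e) \<in> nbhd G (p, q)" using e 1 by (simp add: mem_nbhd_cart_prod)
    then have "(a, e) \<in> closed_nbhd G S" using u(2) e(2) by blast
    then have "(a1, e) \<in> S" using end_dominated[OF T a] by blast
    moreover have "(a1, e) \<in> nbhd G (a1, q)" using e(1) v by (simp add: mem_nbhd_cart_prod)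
    ultimately show ?thesis using tightD(2)[OF T s] by blast
  next
    case 2
    then show ?thesis using u by blast
  qed
qed

text \<open>The corner would have to be forced by \<open>(a1, b)\<close>, itself dominated from
  \<open>(a1, b1)\<close>. The next vertex \<open>(e, b)\<close> along the border must then be
  dominated too, which puts \<open>(e, b1)\<close>, adjacent to \<open>(a1, b1)\<close>, into
  \<open>S\<close>.\<close>

lemma corner_not_observed:
  assumes T: "tight S t" and a: "nbhd J a = {a1}" and b: "nbhd J' b = {b1}"
  shows "(a, b) \<notin> P2 S"
proof
  assume "(a, b) \<in> P2 S"
  moreover have "(a1, b) \<notin> S" using tightD(1)[OF T] deg4_factors(4)[of a1 b] b by auto
  ultimately have c: "(a1, b) \<in> closed_nbhd G S" "nbhd G (a1, b) - closed_nbhd G S \<subseteq> {(a, b)}"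
    using end_observed[OF T a] by blast+
  have s: "(a1, b1) \<in> S" using end_dominated'[OF T b c(1)] .
  then have "card (nbhd J a1) = 2" using tightD(1)[OF T] deg4_factors(3) by blast
  then have "\<not> nbhd J a1 \<subseteq> {a}" using card_mono[of "{a}" "nbhd J a1"] by auto
  then obtain e where e: "e \<in> nbhd J a1" "e \<noteq> a" by blast
  have v: "b \<in> verts J'" "b1 \<in> verts J'"
    using b nbhd_sym[of b J' b1] nbhd_subset[OF simple(2)] by blast+
  then have "(e, b) \<in> nbhd G (a1, b)" using e by (simp add: mem_nbhd_cart_prod)
  then have "(e, b) \<in> closed_nbhd G S" using c(2) e(2) by blast
  then have "(e, b1) \<in> S" using end_dominated'[OF T b] by blast
  moreover have "(e, b1) \<in> nbhd G (a1, b1)" using e(1) v by (simp add: mem_nbhd_cart_prod)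
  ultimately show False using tightD(2)[OF T s] by blast
qed

text \<open>In a tight configuration with at least three rounds, the edges leaving the second closure
  form a matching, so such an edge extends to a full row of parallel edges; this row cannot
  reach an end of \<open>J\<close>.\<close>

lemma cut_line:
  assumes T: "tight S t" "t \<ge> 3" and conn: "connected_graph J"
    and c: "c' \<in> nbhd J' c" and x: "x \<in> verts J" "(x, c) \<in> P2 S" "(x, c') \<notin> P2 S"
    and y: "y \<in> verts J"
  shows "(y, c) \<in> P2 S \<and> (y, c') \<notin> P2 S"
proof -
  have S: "S \<subseteq> verts G" using T by (simp add: tight_def)
  have le: "card (active G (P2 S)) \<le> card (forced G (P2 S))"
    using card_closure_le(4)[of S t] T by (simp add: tight_def)
  note sat = forced_saturated[OF finite_pd_closure[OF simple_prod S] le]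
  have cv: "c \<in> verts J'" "c' \<in> verts J'"
    using c nbhd_sym[of c' J' c] nbhd_subset[OF simple(2)] by blast+
  have "v \<in> verts J \<and> (v, c) \<in> P2 S \<and> (v, c') \<notin> P2 S"
    if u: "u \<in> verts J" "(u, c) \<in> P2 S \<and> (u, c') \<notin> P2 S" and v: "v \<in> nbhd J u" for u v
  proof -
    have vv: "v \<in> verts J" "u \<in> nbhd J v" "v \<noteq> u"
      using v nbhd_subset[OF simple(1)] nbhd_sym[of u J v] nbhd_irrefl[OF simple(1)] by blast+
    have n: "(u, c') \<in> nbhd G (u, c)" "(v, c) \<in> nbhd G (u, c)" "(u, c') \<in> nbhd G (v, c')"
      using u c v vv cv by (simp_all add: mem_nbhd_cart_prod)
    \<comment> \<open>\<open>(u, c)\<close> already has the outside neighbour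
      \<open>(u, c')\<close>, so \<open>(v, c)\<close> lies inside; and \<open>(v, c')\<close> lies
      outside, or \<open>(u, c')\<close> would have two neighbours inside.\<close>
    have "(v, c) \<in> P2 S" using sat(1)[of "(u, c)" "(u, c')" "(v, c)"] n u(2) vv(3) by blast
    moreover have "(v, c') \<notin> P2 S" using sat(2)[of "(u, c)" "(v, c')" "(u, c')"] n u(2) vv(3) by blast
    ultimately show ?thesis using vv(1) by blast
  qed
  then show ?thesis
    using connected_graphD[OF conn x(1), of "\<lambda>v. (v, c) \<in> P2 S \<and> (v, c') \<notin> P2 S"] x y by blast
qed

text \<open>Extended to the end of \<open>J\<close>, the row of parallel edges makes
  \<open>(a, c)\<close> observed while \<open>(a1, c')\<close> is undominated, which contradicts
  both alternatives of \<open>end_observed\<close>.\<close>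

lemma no_cut:
  assumes T: "tight S t" "t \<ge> 3" and conn: "connected_graph J" and a: "nbhd J a = {a1}"
    and c: "c' \<in> nbhd J' c" and x: "x \<in> verts J" "(x, c) \<in> P2 S"
  shows "(x, c') \<in> P2 S"
proof (rule ccontr)
  assume x': "(x, c') \<notin> P2 S"
  have av: "a \<in> verts J" "a1 \<in> verts J" "a1 \<noteq> a"
    using a nbhd_sym[of a J a1] nbhd_subset[OF simple(1)] nbhd_irrefl[OF simple(1)] by blast+
  have l: "(y, c) \<in> P2 S \<and> (y, c') \<notin> P2 S" if "y \<in> verts J" for y
    using cut_line[OF T conn c x x' that] .
  have n: "(a1, c') \<in> nbhd G (a1, c)" using c av by (simp add: mem_nbhd_cart_prod)
  have "(a1, c') \<notin> closed_nbhd G S" using l[OF av(2)] P2_eq by blast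
  then show False
    using end_observed[OF T(1) a, of c] l[OF av(1)] n av(3) P1_iff by blast
qed

text \<open>By \<open>no_cut\<close> no edge along \<open>J'\<close> leaves the second closure, so
  connectedness of \<open>J'\<close> spreads observation over the fibre.\<close>

lemma fibre_observed:
  assumes T: "tight S t" "t \<ge> 3" and conn: "connected_graph J" "connected_graph J'"
    and a: "nbhd J a = {a1}" and x: "(x, c) \<in> P2 S" and d: "d \<in> verts J'"
  shows "(x, d) \<in> P2 S"
proof -
  have "S \<subseteq> verts G" using T by (simp add: tight_def)
  then have "(x, c) \<in> verts G" using subsetD[OF pd_closure_subset[OF simple_prod] x] by blast
  then have v: "x \<in> verts J" "c \<in> verts J'" by (simp_all add: verts_cart_prod)
  have "c' \<in> verts J' \<and> (x, c') \<in> P2 S" if "(x, e) \<in> P2 S" "c' \<in> nbhd J' e" for e c'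
    using no_cut[OF T conn(1) a that(2) v(1) that(1)] that(2) nbhd_subset[OF simple(2)] by blast
  then show ?thesis
    using connected_graphD[OF conn(2) v(2), of "\<lambda>c. (x, c) \<in> P2 S"] x d by blast
qed

text \<open>The second closure is a union of whole copies of \<open>J'\<close> and has exactly
  \<open>8 * card S\<close> elements.\<close>

lemma tight_dvd:
  assumes T: "tight S t" "t \<ge> 3" and conn: "connected_graph J" "connected_graph J'"
    and a: "nbhd J a = {a1}"
  shows "card (verts J') dvd 8 * card S"
proof -
  have S: "S \<subseteq> verts G" using T by (simp add: tight_def)
  have "P2 S \<subseteq> verts J \<times> verts J'"
    using pd_closure_subset[OF simple_prod S, of 2] unfolding verts_cart_prod .
  then have "P2 S \<subseteq> fst ` P2 S \<times> verts J'" by force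
  moreover have "fst ` P2 S \<times> verts J' \<subseteq> P2 S"
    using fibre_observed[OF T conn a] by fastforce
  ultimately have "P2 S = fst ` P2 S \<times> verts J'" by blast
  then have "card (P2 S) = card (fst ` P2 S) * card (verts J')"
    by (metis card_cartesian_product)
  moreover have "card (P2 S) = 8 * card S" using card_closure_le(3)[of S t] T by (simp add: tight_def)
  ultimately show ?thesis by (metis dvd_triv_right)
qed

lemma tight_swap: "tight S t \<Longrightarrow> chain_product.tight J' J (prod.swap ` S) t"
  using chain_product.tight_def[OF chain_product_swap] pd_closure_swap[of J' J S] verts_swap[of J' J]
  by (simp add: tight_def card_swap image_mono)

text \<open>With \<open>t = 2\<close> the corner is missed outright. For \<open>t \<ge> 3\<close>,
  an end in each factor lets \<open>fibre_observed\<close> act in both directions, and the nonempty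
  second closure would reach the corner.\<close>

lemma not_tight_ends:
  assumes conn: "connected_graph J" "connected_graph J'"
    and a: "nbhd J a = {a1}" and b: "nbhd J' b = {b1}"
  shows "\<not> tight S t"
proof
  assume T: "tight S t"
  have "a \<in> verts J" "b \<in> verts J'"
    using a b nbhd_sym[of a J a1] nbhd_sym[of b J' b1] nbhd_subset[OF simple(1)]
      nbhd_subset[OF simple(2)] by blast+
  then have v: "(a, b) \<in> verts G" by (simp add: verts_cart_prod)
  then have t: "t \<ge> 3"
    using corner_not_observed[OF T a b] T by (cases "t = 2") (auto simp: tight_def)
  have "card (verts G) > 0" using v finite_verts[OF simple_prod] by (auto simp: card_gt_0_iff)
  then have S: "card S > 0" using T by (cases "card S") (auto simp: tight_def)
  have "card (P2 S) = 8 * card S" using card_closure_le(3)[of S t] T by (simp add: tight_def)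
  then have "P2 S \<noteq> {}" using S by auto
  then obtain x c where xc: "(x, c) \<in> P2 S" by auto
  have row: "(x, b) \<in> P2 S" using fibre_observed[OF T t conn a xc] v by (simp add: verts_cart_prod)
  interpret sw: chain_product J' J by (rule chain_product_swap)
  have "(b, x) \<in> sw.P2 (prod.swap ` S)" using row by (force simp: pd_closure_swap)
  then have "(b, a) \<in> sw.P2 (prod.swap ` S)"
    using sw.fibre_observed[OF tight_swap[OF T] t conn(2,1) b] v by (simp add: verts_cart_prod)
  then show False using corner_not_observed[OF T a b] by (auto simp: pd_closure_swap)
qed

end

section \<open>Dominating sets of grids\<close>

definition chain_graph :: "bool \<Rightarrow> nat \<Rightarrow> nat graph" where
  "chain_graph c k = (if c then cycle_graph k else path_graph k)"

text \<open>Adjacency of positions without \<open>mod\<close>: computable, and visibly monotone in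
  the flag \<open>c\<close> that adds the wrap-around. Range conditions are stated
  separately.\<close>

definition near :: "bool \<Rightarrow> nat \<Rightarrow> nat \<Rightarrow> nat \<Rightarrow> bool" where
  "near c k a i \<longleftrightarrow> a = Suc i \<or> i = Suc a \<or> c \<and> (a = 0 \<and> Suc i = k \<or> i = 0 \<and> Suc a = k)"

lemma verts_chain_graph: "verts (chain_graph c k) = {..<k}"
  by (simp add: chain_graph_def path_graph_def cycle_graph_def verts_def)

lemma nbhd_chain_graph: "nbhd (chain_graph c k) i = {a. i < k \<and> a < k \<and> near c k a i}"
proof (cases c)
  case True
  have nb: "a \<in> nbhd (cycle_graph k) i \<longleftrightarrow> i < k \<and> a < k \<and> (a = Suc i mod k \<or> i = Suc a mod k)" for a
  proof -
    have "a \<in> nbhd (cycle_graph k) i \<longleftrightarrow> (\<exists>p<k. {i, a} = {p, Suc p mod k})"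
      by (simp add: cycle_graph_def nbhd_def edges_def) blast
    also have "\<dots> \<longleftrightarrow> i < k \<and> a = Suc i mod k \<or> a < k \<and> i = Suc a mod k"
      unfolding doubleton_eq_iff by blast
    also have "\<dots> \<longleftrightarrow> i < k \<and> a < k \<and> (a = Suc i mod k \<or> i = Suc a mod k)"
    proof -
      have lt: "Suc p mod k < k" if "p < k" for p using that by (intro mod_less_divisor) auto
      show ?thesis using lt[of i] lt[of a] by metis
    qed
    finally show ?thesis .
  qed
  have md: "a = Suc i mod k \<longleftrightarrow> a = Suc i \<or> a = 0 \<and> Suc i = k" if "i < k" "a < k" for a i
  proof (cases "Suc i = k")
    case False
    then have "Suc i mod k = Suc i" using that(1) by simp
    then show ?thesis using False by simp
  qed (use that in auto)
  have "a \<in> nbhd (cycle_graph k) i \<longleftrightarrow> i < k \<and> a < k \<and> near True k a i" for a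
    unfolding nb near_def using md[of i a] md[of a i] by metis
  then show ?thesis using True unfolding chain_graph_def by auto
next
  case False
  then show ?thesis
    by (auto simp: chain_graph_def path_graph_def nbhd_def edges_def near_def doubleton_eq_iff)
qed

lemma simple_chain_graph: "k \<ge> 3 \<Longrightarrow> simple_graph (chain_graph c k)"
  by (simp add: chain_graph_def simple_graph_path_graph simple_graph_cycle_graph)

lemma card_nbhd_chain_graph: "card (nbhd (chain_graph c k) i) \<le> 2"
proof -
  have "nbhd (chain_graph c k) i \<subseteq> {if Suc i = k then 0 else Suc i, if i = 0 then k - 1 else i - 1}"
    by (auto simp: nbhd_chain_graph near_def)
  then show ?thesis by (rule order_trans[OF card_mono, rotated]) (auto simp: card_insert_if)
qed

lemma connected_chain_graph: "connected_graph (chain_graph c k)"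
  unfolding connected_graph_def
proof (intro allI impI)
  fix X assume X: "X \<subseteq> verts (chain_graph c k)" "X \<noteq> {}" "\<forall>x\<in>X. nbhd (chain_graph c k) x \<subseteq> X"
  have step: "a \<in> X" if "i \<in> X" "i < k" "a < k" "near c k a i" for a i
    using X(3) that unfolding nbhd_chain_graph by blast
  have lt: "i < k" if "i \<in> X" for i using X(1) that by (auto simp: verts_chain_graph)
  have up: "Suc i \<in> X" if "i \<in> X" "Suc i < k" for i
    using step[OF that(1) lt[OF that(1)] that(2)] by (simp add: near_def)
  have down: "i \<in> X" if "Suc i \<in> X" for i
    using step[OF that lt[OF that], of i] lt[OF that] by (simp add: near_def)
  obtain x where x: "x \<in> X" using X(2) by blast
  have "0 \<in> X" using x by (induction x) (use down in auto)
  then have "i \<in> X" if "i < k" for i using that by (induction i) (use up in auto)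
  then show "X = verts (chain_graph c k)" using X(1) by (auto simp: verts_chain_graph)
qed

lemma nbhd_path_end: "k \<ge> 2 \<Longrightarrow> nbhd (chain_graph False k) 0 = {1}"
  by (auto simp: nbhd_chain_graph near_def)

text \<open>Only an upper bound on the size is kept; it survives gluing, enlarging and closing paths
  into cycles.\<close>

definition dominable :: "'a graph \<Rightarrow> nat \<Rightarrow> bool" where
  "dominable G k \<longleftrightarrow> (\<exists>D. dominating_set G D \<and> card D \<le> k)"

section \<open>Grids in coordinates\<close>

definition grid :: "bool \<Rightarrow> nat \<Rightarrow> bool \<Rightarrow> nat \<Rightarrow> (nat \<times> nat) graph" where
  "grid c n c' m = chain_graph c n \<box> chain_graph c' m"

lemma mem_nbhd_grid:
  "(a, b) \<in> nbhd (grid c n c' m) (i, j) \<longleftrightarrow>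
    i < n \<and> a < n \<and> j < m \<and> b < m \<and> (a = i \<and> near c' m b j \<or> b = j \<and> near c n a i)"
  by (auto simp: grid_def mem_nbhd_cart_prod verts_chain_graph nbhd_chain_graph)

lemma verts_grid: "verts (grid c n c' m) = {..<n} \<times> {..<m}"
  by (simp add: grid_def verts_cart_prod verts_chain_graph)

lemma near_sym: "near c k a i = near c k i a"
  by (auto simp: near_def)

lemma dominating_set_grid:
  "dominating_set (grid c n c' m) D \<longleftrightarrow> D \<subseteq> {..<n} \<times> {..<m} \<and>
    (\<forall>i<n. \<forall>j<m. \<exists>a b. (a, b) \<in> D \<and>
      (a = i \<and> (b = j \<or> near c' m b j) \<or> b = j \<and> near c n a i))"
proof (cases "D \<subseteq> {..<n} \<times> {..<m}")
  case True
  define Q where "Q i j \<longleftrightarrow> (\<exists>a b. (a, b) \<in> D \<and>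
      (a = i \<and> (b = j \<or> near c' m b j) \<or> b = j \<and> near c n a i))" for i j
  have "(i, j) \<in> closed_nbhd (grid c n c' m) D \<longleftrightarrow> i < n \<and> j < m \<and> Q i j" for i j
  proof -
    have "(i, j) \<in> closed_nbhd (grid c n c' m) D \<longleftrightarrow>
        (i, j) \<in> D \<or> (\<exists>a b. (a, b) \<in> D \<and> (i, j) \<in> nbhd (grid c n c' m) (a, b))"
      by (auto simp: closed_nbhd_def)
    then show ?thesis
      using True unfolding mem_nbhd_grid near_sym[of _ _ i] near_sym[of _ _ j] Q_def by auto
  qed
  then show ?thesis
    using True unfolding dominating_set_def verts_grid set_eq_iff split_paired_All Q_def[symmetric]
    by (simp add: mem_Times_iff) blast
qed (simp add: dominating_set_def verts_grid)

lemma dominable_mono: "dominable G k \<Longrightarrow> k \<le> l \<Longrightarrow> dominable G l"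
  unfolding dominable_def by (meson le_trans)

text \<open>Closing a path into a cycle only adds edges.\<close>

lemma dominable_cycle:
  assumes "dominable (grid c n c' m) k" "c \<Longrightarrow> d" "c' \<Longrightarrow> d'"
  shows "dominable (grid d n d' m) k"
proof -
  have "near d n a i" if "near c n a i" for a i using that assms(2) by (auto simp: near_def)
  moreover have "near d' m a i" if "near c' m a i" for a i using that assms(3) by (auto simp: near_def)
  ultimately have "dominating_set (grid d n d' m) D" if "dominating_set (grid c n c' m) D" for D
    using that unfolding dominating_set_grid by meson
  then show ?thesis using assms(1) unfolding dominable_def by blast
qed

lemma dominable_swap:
  assumes "dominable (grid c n c' m) k" shows "dominable (grid c' m c n) k"
proof -
  obtain D where "dominating_set (grid c n c' m) D" "card D \<le> k"
    using assms by (auto simp: dominable_def)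
  then have "dominating_set (grid c' m c n) (prod.swap ` D)" "card (prod.swap ` D) \<le> k"
    by (simp_all add: grid_def dominating_set_swap card_swap)
  then show ?thesis unfolding dominable_def by blast
qed

abbreviation "pgrid n m \<equiv> grid False n False m"

text \<open>The two grids are placed side by side, the second shifted by \<open>m\<close>. Path
  blocks have no wrap-around edges that the gluing could destroy.\<close>

lemma dominable_add:
  assumes "dominable (pgrid n m) k" "dominable (pgrid n m') k'"
  shows "dominable (pgrid n (m + m')) (k + k')"
proof -
  obtain D D' where D: "dominating_set (pgrid n m) D" "card D \<le> k"
    and D': "dominating_set (pgrid n m') D'" "card D' \<le> k'"
    using assms by (auto simp: dominable_def)
  let ?E = "D \<union> (\<lambda>(a, b). (a, m + b)) ` D'"
  have "D' \<subseteq> {..<n} \<times> {..<m'}" using D'(1) by (simp add: dominating_set_grid)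
  then have "finite D'" by (rule finite_subset) simp
  then have "card ?E \<le> k + k'"
    using D(2) D'(2) card_Un_le[of D "(\<lambda>(a, b). (a, m + b)) ` D'"]
      card_image_le[of D' "\<lambda>(a, b). (a, m + b)"] by linarith
  moreover have "\<exists>a b. (a, b) \<in> ?E \<and>
      (a = i \<and> (b = j \<or> near False (m + m') b j) \<or> b = j \<and> near False n a i)"
    if i: "i < n" and j: "j < m + m'" for i j
  proof (cases "j < m")
    case True
    then obtain a b where "(a, b) \<in> D" "a = i \<and> (b = j \<or> near False m b j) \<or> b = j \<and> near False n a i"
      using D(1) i unfolding dominating_set_grid by blast
    then have "(a, b) \<in> ?E"
        "a = i \<and> (b = j \<or> near False (m + m') b j) \<or> b = j \<and> near False n a i"
      by (auto simp: near_def)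
    then show ?thesis by blast
  next
    case False
    then have "j - m < m'" using j by simp
    then obtain a b where "(a, b) \<in> D'"
        "a = i \<and> (b = j - m \<or> near False m' b (j - m)) \<or> b = j - m \<and> near False n a i"
      using D'(1) i unfolding dominating_set_grid by blast
    then have "(a, m + b) \<in> ?E"
        "a = i \<and> (m + b = j \<or> near False (m + m') (m + b) j) \<or> m + b = j \<and> near False n a i"
      using False by (force simp: near_def)+
    then show ?thesis by blast
  qed
  moreover have "?E \<subseteq> {..<n} \<times> {..<m + m'}"
    using D(1) \<open>D' \<subseteq> {..<n} \<times> {..<m'}\<close> unfolding dominating_set_grid by fastforce
  ultimately have "dominating_set (pgrid n (m + m')) ?E \<and> card ?E \<le> k + k'"
    unfolding dominating_set_grid by (intro conjI allI impI) assumption+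
  then show ?thesis unfolding dominable_def by blast
qed

text \<open>An executable certificate for a listed candidate set; the length bounds the size even if
  entries repeat.\<close>

definition grid_check :: "bool \<Rightarrow> nat \<Rightarrow> bool \<Rightarrow> nat \<Rightarrow> nat \<Rightarrow> (nat \<times> nat) list \<Rightarrow> bool" where
  "grid_check c n c' m k xs \<longleftrightarrow> length xs \<le> k \<and> list_all (\<lambda>(a, b). a < n \<and> b < m) xs \<and>
    list_all (\<lambda>i. list_all (\<lambda>j.
      list_ex (\<lambda>(a, b). a = i \<and> (b = j \<or> near c' m b j) \<or> b = j \<and> near c n a i) xs) [0..<m]) [0..<n]"

lemma dominable_check:
  assumes "grid_check c n c' m k xs" shows "dominable (grid c n c' m) k"
proof -
  have "dominating_set (grid c n c' m) (set xs)"
    unfolding dominating_set_grid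
  proof (intro conjI allI impI)
    show "set xs \<subseteq> {..<n} \<times> {..<m}"
      using assms by (auto simp: grid_check_def list_all_iff)
    fix i j assume "i < n" "j < m"
    then have "list_ex (\<lambda>(a, b). a = i \<and> (b = j \<or> near c' m b j) \<or> b = j \<and> near c n a i) xs"
      using assms by (simp add: grid_check_def list_all_iff)
    then show "\<exists>a b. (a, b) \<in> set xs \<and> (a = i \<and> (b = j \<or> near c' m b j) \<or> b = j \<and> near c n a i)"
      unfolding list_ex_iff by blast
  qed
  moreover have "card (set xs) \<le> k"
    using assms card_length[of xs] by (simp add: grid_check_def)
  ultimately show ?thesis by (auto simp: dominable_def)
qed

text \<open>The blocks for the later gluings. All but the last four attain \<lceil>nm/4\<rceil>; the
  last four have exceptional sizes and use one vertex more.\<close>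

lemma dominable_paths:
  shows "dominable (pgrid 4 4) 4"
    and "dominable (pgrid 4 7) 7"
    and "dominable (pgrid 4 10) 10"
    and "dominable (pgrid 4 13) 13"
    and "dominable (pgrid 5 5) 7"
    and "dominable (pgrid 5 6) 8"
    and "dominable (pgrid 5 7) 9"
    and "dominable (pgrid 5 9) 12"
    and "dominable (pgrid 5 10) 13"
    and "dominable (pgrid 5 11) 14"
    and "dominable (pgrid 5 15) 19"
    and "dominable (pgrid 5 16) 20"
    and "dominable (pgrid 5 19) 24"
    and "dominable (pgrid 5 20) 25"
    and "dominable (pgrid 5 24) 30"
    and "dominable (pgrid 5 28) 35"
    and "dominable (pgrid 6 7) 11"
    and "dominable (pgrid 6 8) 12"
    and "dominable (pgrid 6 9) 14"
    and "dominable (pgrid 6 11) 17"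
    and "dominable (pgrid 6 12) 18"
    and "dominable (pgrid 6 14) 21"
    and "dominable (pgrid 6 18) 27"
    and "dominable (pgrid 7 7) 13"
    and "dominable (pgrid 9 8) 18"
    and "dominable (pgrid 9 12) 27"
    and "dominable (pgrid 9 9) 21"
    and "dominable (pgrid 10 10) 25"
    and "dominable (pgrid 4 5) 6"
    and "dominable (pgrid 4 6) 7"
    and "dominable (pgrid 5 8) 11"
    and "dominable (pgrid 6 6) 10"
  apply (rule dominable_check[where xs = "[(1, 0), (3, 1), (0, 2), (2, 3)]"], code_simp)
  apply (rule dominable_check[where xs = "[(1, 0), (3, 1), (0, 2), (2, 3), (0, 4), (3, 5), (1,
    6)]"], code_simp)
  apply (rule dominable_check[where xs = "[(1, 0), (3, 1), (0, 2), (2, 3), (0, 4), (3, 5), (1, 6),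
    (3, 7), (0, 8), (2, 9)]"], code_simp)
  apply (rule dominable_check[where xs = "[(1, 0), (3, 1), (0, 2), (2, 3), (0, 4), (3, 5), (1, 6),
    (3, 7), (0, 8), (2, 9), (0, 10), (3, 11), (1, 12)]"], code_simp)
  apply (rule dominable_check[where xs = "[(1, 0), (3, 1), (4, 1), (0, 2), (2, 3), (0, 4), (4,
    4)]"], code_simp)
  apply (rule dominable_check[where xs = "[(2, 0), (0, 1), (4, 1), (1, 2), (3, 3), (0, 4), (4, 4),
    (2, 5)]"], code_simp)
  apply (rule dominable_check[where xs = "[(2, 0), (0, 1), (4, 1), (1, 3), (2, 3), (3, 3), (0, 5),
    (4, 5), (2, 6)]"], code_simp)
  apply (rule dominable_check[where xs = "[(2, 0), (0, 1), (4, 1), (2, 2), (0, 3), (3, 4), (4, 4),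
    (1, 5), (3, 6), (0, 7), (2, 8), (4, 8)]"], code_simp)
  apply (rule dominable_check[where xs = "[(1, 0), (3, 1), (4, 1), (0, 2), (2, 3), (4, 4), (0, 5),
    (1, 5), (3, 6), (2, 7), (0, 8), (4, 8), (2, 9)]"], code_simp)
  apply (rule dominable_check[where xs = "[(0, 0), (2, 0), (4, 1), (1, 2), (3, 3), (0, 4), (2, 5),
    (4, 5), (0, 6), (3, 7), (1, 8), (4, 9), (0, 10), (2, 10)]"], code_simp)
  apply (rule dominable_check[where xs = "[(2, 0), (0, 1), (4, 1), (1, 2), (3, 3), (0, 4), (2, 5),
    (4, 5), (0, 6), (3, 7), (1, 8), (4, 9), (0, 10), (2, 10), (3, 11), (1, 12), (0, 13), (4, 13),
    (2, 14)]"], code_simp)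
  apply (rule dominable_check[where xs = "[(2, 0), (4, 0), (0, 1), (3, 2), (1, 3), (4, 4), (0, 5),
    (2, 5), (4, 6), (1, 7), (3, 8), (0, 9), (2, 10), (4, 10), (0, 11), (3, 12), (1, 13), (4, 14),
    (0, 15), (2, 15)]"], code_simp)
  apply (rule dominable_check[where xs = "[(2, 0), (0, 1), (4, 1), (2, 2), (2, 3), (0, 4), (4, 4),
    (3, 5), (1, 6), (4, 7), (0, 8), (2, 8), (4, 9), (1, 10), (3, 11), (0, 12), (2, 13), (4, 13), (0,
    14), (3, 15), (1, 16), (0, 17), (4, 17), (2, 18)]"], code_simp)
  apply (rule dominable_check[where xs = "[(2, 0), (0, 1), (4, 1), (1, 2), (3, 3), (0, 4), (2, 5),
    (4, 5), (0, 6), (3, 7), (1, 8), (4, 9), (0, 10), (2, 10), (1, 12), (3, 12), (4, 12), (0, 14),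
    (2, 14), (4, 15), (1, 16), (3, 17), (0, 18), (4, 18), (2, 19)]"], code_simp)
  apply (rule dominable_check[where xs = "[(2, 0), (0, 1), (4, 1), (1, 2), (3, 3), (0, 4), (2, 5),
    (4, 5), (0, 6), (3, 7), (1, 8), (4, 9), (0, 10), (2, 10), (4, 11), (1, 12), (3, 13), (0, 14),
    (2, 15), (4, 15), (0, 16), (3, 17), (1, 18), (0, 19), (4, 19), (2, 20), (2, 21), (0, 22), (4,
    22), (2, 23)]"], code_simp)
  apply (rule dominable_check[where xs = "[(2, 0), (0, 1), (4, 1), (1, 2), (3, 3), (0, 4), (2, 5),
    (4, 5), (0, 6), (3, 7), (1, 8), (4, 9), (0, 10), (2, 10), (1, 12), (3, 12), (4, 12), (0, 14),
    (2, 14), (4, 15), (1, 16), (3, 17), (0, 18), (2, 18), (4, 19), (1, 20), (3, 21), (0, 22), (2,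
    22), (4, 23), (1, 24), (3, 25), (0, 26), (4, 26), (2, 27)]"], code_simp)
  apply (rule dominable_check[where xs = "[(1, 0), (4, 0), (3, 1), (0, 2), (5, 2), (2, 3), (4, 4),
    (0, 5), (1, 5), (5, 5), (3, 6)]"], code_simp)
  apply (rule dominable_check[where xs = "[(2, 0), (4, 0), (0, 1), (3, 2), (5, 2), (1, 3), (4, 4),
    (0, 5), (2, 5), (5, 6), (1, 7), (3, 7)]"], code_simp)
  apply (rule dominable_check[where xs = "[(0, 0), (4, 0), (2, 1), (1, 2), (5, 2), (3, 3), (0, 4),
    (2, 5), (4, 5), (5, 5), (0, 6), (3, 7), (1, 8), (5, 8)]"], code_simp)
  apply (rule dominable_check[where xs = "[(1, 0), (3, 0), (5, 1), (0, 2), (2, 2), (4, 3), (1, 4),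
    (3, 5), (5, 5), (0, 6), (1, 6), (4, 7), (2, 8), (0, 9), (5, 9), (2, 10), (3, 10)]"], code_simp)
  apply (rule dominable_check[where xs = "[(2, 0), (4, 0), (0, 1), (3, 2), (5, 2), (1, 3), (4, 4),
    (0, 5), (2, 5), (5, 6), (1, 7), (3, 7), (5, 8), (0, 9), (2, 9), (4, 10), (1, 11), (4, 11)]"],
    code_simp)
  apply (rule dominable_check[where xs = "[(3, 0), (5, 0), (0, 1), (1, 1), (4, 2), (2, 3), (0, 4),
    (5, 4), (3, 5), (1, 6), (3, 6), (5, 7), (0, 8), (2, 8), (4, 9), (1, 10), (3, 11), (5, 11), (0,
    12), (2, 13), (4, 13)]"], code_simp)
  apply (rule dominable_check[where xs = "[(1, 0), (5, 0), (3, 1), (0, 2), (4, 2), (2, 3), (0, 4),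
    (5, 4), (3, 5), (1, 6), (4, 7), (5, 7), (0, 8), (2, 8), (4, 9), (1, 10), (3, 11), (5, 11), (0,
    12), (2, 12), (4, 13), (1, 14), (3, 15), (5, 15), (0, 16), (2, 17), (4, 17)]"], code_simp)
  apply (rule dominable_check[where xs = "[(0, 0), (3, 0), (3, 1), (5, 1), (6, 1), (1, 2), (2, 3),
    (4, 3), (0, 4), (6, 4), (3, 5), (1, 6), (5, 6)]"], code_simp)
  apply (rule dominable_check[where xs = "[(0, 0), (2, 0), (6, 0), (4, 1), (8, 1), (1, 2), (6, 2),
    (3, 3), (8, 3), (0, 4), (5, 4), (2, 5), (7, 5), (0, 6), (4, 6), (2, 7), (6, 7), (8, 7)]"],
    code_simp)
  apply (rule dominable_check[where xs = "[(1, 0), (3, 0), (7, 0), (5, 1), (0, 2), (2, 2), (4, 2),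
    (8, 2), (6, 3), (1, 4), (3, 4), (5, 5), (7, 5), (8, 5), (0, 6), (2, 6), (4, 7), (6, 7), (1, 8),
    (8, 8), (3, 9), (5, 9), (0, 10), (7, 10), (2, 11), (4, 11), (7, 11)]"], code_simp)
  apply (rule dominable_check[where xs = "[(1, 0), (3, 0), (7, 0), (5, 1), (0, 2), (2, 2), (7, 2),
    (8, 2), (4, 3), (1, 4), (4, 4), (6, 4), (8, 5), (0, 6), (2, 6), (3, 6), (5, 6), (7, 7), (1, 8),
    (4, 8), (7, 8)]"], code_simp)
  apply (rule dominable_check[where xs = "[(0, 0), (2, 0), (5, 0), (8, 0), (4, 1), (1, 2), (6, 2),
    (7, 2), (9, 2), (3, 3), (0, 4), (5, 4), (8, 4), (2, 5), (7, 5), (4, 6), (9, 6), (0, 7), (1, 7),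
    (6, 7), (3, 8), (8, 8), (1, 9), (5, 9), (8, 9)]"], code_simp)
  apply (rule dominable_check[where xs = "[(1, 0), (2, 0), (0, 2), (3, 2), (1, 4), (2, 4)]"],
    code_simp)
  apply (rule dominable_check[where xs = "[(1, 0), (1, 1), (3, 1), (0, 3), (2, 3), (1, 5), (3,
    5)]"], code_simp)
  apply (rule dominable_check[where xs = "[(0, 0), (2, 0), (4, 1), (1, 2), (3, 3), (0, 4), (0, 5),
    (2, 5), (4, 5), (1, 7), (3, 7)]"], code_simp)
  apply (rule dominable_check[where xs = "[(0, 0), (2, 0), (4, 1), (5, 1), (1, 2), (3, 3), (0, 4),
    (1, 4), (5, 4), (3, 5)]"], code_simp)
  done

text \<open>At exceptional sizes one cycle factor brings the size down to nm/4. The path on 4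
  vertices times the cycle on 5 or 9 is absent on purpose: there \<open>grid_not_tight\<close>
  excludes equality instead.\<close>

lemma dominable_cycles:
  shows "dominable (grid True 4 False 5) 5"
    and "dominable (grid False 4 True 6) 6"
    and "dominable (grid True 4 False 6) 6"
    and "dominable (grid True 4 False 9) 9"
    and "dominable (grid False 5 True 8) 10"
    and "dominable (grid True 5 False 8) 10"
    and "dominable (grid False 6 True 6) 9"
    and "dominable (grid False 5 True 12) 15"
    and "dominable (grid True 5 False 12) 15"
    and "dominable (grid False 6 True 10) 15"
    and "dominable (grid True 6 False 10) 15"
  apply (rule dominable_check[where xs = "[(0, 0), (2, 1), (0, 2), (1, 3), (3, 4)]"], code_simp)
  apply (rule dominable_check[where xs = "[(1, 0), (3, 1), (0, 2), (2, 3), (0, 4), (3, 5)]"],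
    code_simp)
  apply (rule dominable_check[where xs = "[(3, 0), (1, 1), (0, 2), (2, 3), (3, 4), (1, 5)]"],
    code_simp)
  apply (rule dominable_check[where xs = "[(2, 0), (0, 1), (1, 2), (3, 3), (2, 4), (0, 5), (0, 6),
    (2, 7), (0, 8)]"], code_simp)
  apply (rule dominable_check[where xs = "[(1, 0), (4, 0), (1, 1), (3, 2), (0, 3), (2, 4), (4, 4),
    (0, 5), (3, 6), (1, 7)]"], code_simp)
  apply (rule dominable_check[where xs = "[(0, 0), (2, 1), (3, 1), (1, 2), (4, 3), (2, 4), (0, 5),
    (3, 6), (1, 7), (4, 7)]"], code_simp)
  apply (rule dominable_check[where xs = "[(2, 0), (4, 0), (5, 0), (0, 1), (3, 2), (1, 3), (5, 3),
    (3, 4), (0, 5)]"], code_simp)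
  apply (rule dominable_check[where xs = "[(1, 0), (4, 0), (0, 2), (2, 2), (3, 2), (1, 4), (4, 4),
    (1, 5), (3, 6), (0, 7), (2, 8), (4, 8), (0, 9), (3, 10), (1, 11)]"], code_simp)
  apply (rule dominable_check[where xs = "[(1, 0), (3, 0), (0, 1), (2, 2), (1, 3), (4, 3), (4, 4),
    (2, 5), (0, 6), (3, 7), (1, 8), (4, 9), (2, 10), (3, 10), (0, 11)]"], code_simp)
  apply (rule dominable_check[where xs = "[(2, 0), (5, 1), (0, 2), (1, 2), (3, 2), (2, 4), (4, 4),
    (5, 4), (0, 5), (3, 6), (1, 7), (5, 7), (2, 8), (0, 9), (4, 9)]"], code_simp)
  apply (rule dominable_check[where xs = "[(1, 0), (3, 0), (5, 1), (2, 2), (0, 3), (4, 3), (0, 4),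
    (2, 4), (5, 5), (1, 6), (3, 6), (5, 7), (2, 8), (0, 9), (4, 9)]"], code_simp)
  done

section \<open>Path grids of arbitrary size\<close>

lemma dominable_addI:
  "\<lbrakk>dominable (pgrid n m) k; dominable (pgrid n m') k'; l = m + m'; k + k' \<le> k''\<rbrakk>
    \<Longrightarrow> dominable (pgrid n l) k''"
  using dominable_add dominable_mono by blast

lemma dominable_4:
  assumes "m \<ge> 4" "m \<noteq> 5" "m \<noteq> 6" "m \<noteq> 9"
  shows "dominable (pgrid 4 m) m"
  using assms
proof (induction m rule: less_induct)
  case (less m)
  \<comment> \<open>The lengths from which no 4 by 4 block can be split off: 4 and 7 leave too
    little, 10 and 13 leave the excluded 6 and 9.\<close>
  consider "m = 4" | "m = 7" | "m = 10" | "m = 13" | "m - 4 \<ge> 4" "m - 4 \<noteq> 5" "m - 4 \<noteq> 6" "m - 4 \<noteq> 9"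
    using less.prems by linarith
  then show ?case
  proof cases
    case 5
    then have "dominable (pgrid 4 (m - 4)) (m - 4)" by (intro less.IH) auto
    then show ?thesis by (rule dominable_addI[OF _ dominable_paths(1)]) (use 5 in auto)
  qed (use dominable_paths in simp_all)
qed

text \<open>\<open>(5 * m + 3) div 4\<close> is the quarter rounded up. The induction splits off a
  block of width 16, whose 20 vertices are an exact quarter, so that nothing is lost to
  rounding.\<close>

lemma dominable_5:
  assumes "m \<ge> 5" "m \<noteq> 8" "m \<noteq> 12"
  shows "dominable (pgrid 5 m) ((5 * m + 3) div 4)"
  using assms
proof (induction m rule: less_induct)
  case (less m)
  have p: "dominable (pgrid 5 13) 17" "dominable (pgrid 5 14) 18" "dominable (pgrid 5 17) 22"
    "dominable (pgrid 5 18) 23"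
    using dominable_add[OF dominable_paths(6,7)] dominable_add[OF dominable_paths(7,7)]
      dominable_add[OF dominable_paths(7,9)] dominable_add[OF dominable_paths(7,10)] by simp_all
  show ?case
  \<comment> \<open>24 and 28 are base cases because removing 16 would leave the excluded 8 and
    12.\<close>
  proof (cases "m \<in> {5..7} \<union> {9..11} \<union> {13..20} \<union> {24, 28}")
    case True
    then have "m \<in> {5,6,7,9,10,11,13,14,15,16,17,18,19,20,24,28}"
      by (auto simp: atLeastAtMost_iff)
    then show ?thesis using p dominable_paths by auto
  next
    case False
    then have m: "m - 16 \<ge> 5" "m - 16 \<noteq> 8" "m - 16 \<noteq> 12" using less.prems by auto
    then have "dominable (pgrid 5 (m - 16)) ((5 * (m - 16) + 3) div 4)" by (intro less.IH) auto
    then show ?thesis by (rule dominable_addI[OF _ dominable_paths(12)]) (use m in presburger)+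
  qed
qed

text \<open>The same scheme with blocks of width 8 and exactly 12 vertices; 14 and 18 are base
  cases, as they would lead to 6 and 10.\<close>

lemma dominable_6:
  assumes "m \<ge> 5" "m \<noteq> 6" "m \<noteq> 10"
  shows "dominable (pgrid 6 m) ((6 * m + 3) div 4)"
  using assms
proof (induction m rule: less_induct)
  case (less m)
  have "dominable (pgrid 6 5) 8" using dominable_swap[OF dominable_paths(6)] .
  show ?case
  proof (cases "m \<in> {5, 7, 8, 9, 11, 12, 14, 18}")
    case True
    then show ?thesis using \<open>dominable (pgrid 6 5) 8\<close> dominable_paths by auto
  next
    case False
    then have m: "m - 8 \<ge> 5" "m - 8 \<noteq> 6" "m - 8 \<noteq> 10" using less.prems by (simp; presburger)+
    then have "dominable (pgrid 6 (m - 8)) ((6 * (m - 8) + 3) div 4)" by (intro less.IH) auto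
    then show ?thesis by (rule dominable_addI[OF _ dominable_paths(18)]) (use m in presburger)+
  qed
qed

lemma dominable_7:
  assumes "m \<ge> 4"
  shows "dominable (pgrid 7 m) ((7 * m + 3) div 4)"
  using assms
proof (induction m rule: less_induct)
  case (less m)
  have p: "dominable (pgrid 7 4) 7" "dominable (pgrid 7 5) 9" "dominable (pgrid 7 6) 11"
    using dominable_paths(2,7,17)[THEN dominable_swap] by simp_all
  show ?case
  proof (cases "m \<in> {4, 5, 6, 7}")
    case True
    then show ?thesis using p dominable_paths by auto
  next
    case False
    then have m: "m - 4 \<ge> 4" using less.prems by auto
    then have "dominable (pgrid 7 (m - 4)) ((7 * (m - 4) + 3) div 4)" by (intro less.IH) auto
    then show ?thesis by (rule dominable_addI[OF _ p(1)]) (use m in presburger)+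
  qed
qed

text \<open>The sizes of the path grids whose domination number exceeds \<open>\<lceil>nm/4\<rceil>\<close>; it is then
  \<open>nm/4 + 1\<close>.\<close>

definition exceptional :: "(nat \<times> nat) set" where
  "exceptional = {(4, 5), (4, 6), (4, 9), (5, 8), (5, 12), (6, 6), (6, 10)}"

text \<open>Apart from \<open>m = 4\<close>, which is direct: as \<open>m\<close> is none of 5, 6,
  9, a strip of size \<open>m\<close> by 4 is dominated by \<open>m\<close> vertices. Shortening
  \<open>n\<close> by fours thus loses nothing to rounding and ends in the families for 4 to
  7.\<close>

lemma dominable_quarter_aux:
  assumes "n \<ge> 4" "m \<ge> 4" "m \<noteq> 5" "m \<noteq> 6" "m \<noteq> 9" "(n, m) \<notin> exceptional" "(m, n) \<notin> exceptional"
  shows "dominable (pgrid n m) ((n * m + 3) div 4)"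
proof (cases "m = 4")
  case True
  then have "dominable (pgrid 4 n) n"
    using assms by (intro dominable_4) (auto simp: exceptional_def)
  then show ?thesis using dominable_swap True by simp
next
  case False
  have four: "dominable (pgrid m 4) m" using dominable_swap[OF dominable_4] assms by blast
  show ?thesis using assms(1,6,7)
  proof (induction n rule: less_induct)
    case (less n)
    \<comment> \<open>The three pairs set aside would step down to the exceptional
      \<open>(5, 8)\<close>, \<open>(5, 12)\<close> and \<open>(6, 10)\<close>.\<close>
    have ex: "(n - 4, m) \<notin> exceptional" "(m, n - 4) \<notin> exceptional" 
      if "n \<ge> 8" "(n, m) \<notin> {(9, 8), (9, 12), (10, 10)}"
      using that assms(2-5) False by (auto simp: exceptional_def)
    consider "n = 4" | "n = 5" | "n = 6" | "n = 7" | "(n, m) \<in> {(9, 8), (9, 12), (10, 10)}"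
      | "n \<ge> 8" "(n, m) \<notin> {(9, 8), (9, 12), (10, 10)}" using less.prems(1) by linarith
    then show ?case
    proof cases
      case 1
      then show ?thesis using dominable_4[of m] assms by simp
    next
      case 2
      then show ?thesis using dominable_5[of m] assms False less.prems by (auto simp: exceptional_def)
    next
      case 3
      then show ?thesis using dominable_6[of m] assms False less.prems by (auto simp: exceptional_def)
    next
      case 4
      then show ?thesis using dominable_7[of m] assms by simp
    next
      case 5
      then show ?thesis using dominable_paths by auto
    next
      case 6
      then have "dominable (pgrid (n - 4) m) (((n - 4) * m + 3) div 4)"
        using ex by (intro less.IH) auto
      then have d: "dominable (pgrid m (n - 4)) (((n - 4) * m + 3) div 4)" by (rule dominable_swap)
      have n: "n * m = (n - 4) * m + 4 * m" using 6(1) by (simp add: distrib_right[symmetric])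
      have "dominable (pgrid m n) ((n * m + 3) div 4)"
        by (rule dominable_addI[OF d four]) (use 6(1) n in simp_all)
      then show ?thesis by (rule dominable_swap)
    qed
  qed
qed

lemma dominable_quarter:
  assumes "n \<ge> 4" "m \<ge> 4" "(n, m) \<notin> exceptional" "(m, n) \<notin> exceptional"
  shows "dominable (pgrid n m) ((n * m + 3) div 4)"
proof -
  consider "m \<noteq> 5" "m \<noteq> 6" "m \<noteq> 9" | "n \<noteq> 5" "n \<noteq> 6" "n \<noteq> 9" | "m \<in> {5, 6, 9}" "n \<in> {5, 6, 9}" by blast
  then show ?thesis
  proof cases
    case 1
    then show ?thesis using assms by (intro dominable_quarter_aux)
  next
    case 2
    then have "dominable (pgrid m n) ((m * n + 3) div 4)"
      using assms by (intro dominable_quarter_aux)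
    then show ?thesis using dominable_swap[of False m False n] by (simp add: mult.commute)
  next
    case 3
    then show ?thesis
      using assms(3) dominable_paths(5,6,8,19,27) dominable_paths(6,8,19)[THEN dominable_swap]
      by (auto simp: exceptional_def)
  qed
qed

lemma exceptional_le:
  assumes "(n, m) \<in> exceptional"
  shows "4 dvd n * m" "dominable (pgrid n m) (n * m div 4 + 1)"
proof -
  show "4 dvd n * m" using assms by (auto simp: exceptional_def)
  have "dominable (pgrid 4 9) 10" "dominable (pgrid 5 12) 16" "dominable (pgrid 6 10) 16"
    using dominable_add[OF dominable_paths(29,1)] dominable_add[OF dominable_paths(7,5)]
      dominable_add[OF dominable_paths(6,6)[THEN dominable_swap]] by simp_all
  then show "dominable (pgrid n m) (n * m div 4 + 1)"
    using assms dominable_paths by (auto simp: exceptional_def)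
qed

text \<open>A single cycle factor saves the extra vertex; the last hypothesis sets aside the path on
  4 vertices times the cycle on 5 or 9.\<close>

lemma exceptional_cycle:
  assumes "(n, m) \<in> exceptional" "c \<or> c'" "\<not> (\<not> c \<and> n = 4 \<and> (m = 5 \<or> m = 9))"
  shows "dominable (grid c n c' m) (n * m div 4)"
proof (cases c)
  case True
  have "dominable (grid True 6 False 6) 9" using dominable_swap[OF dominable_cycles(7)] .
  then have "dominable (grid True n False m) (n * m div 4)"
    using assms(1) dominable_cycles by (auto simp: exceptional_def)
  then show ?thesis by (rule dominable_cycle) (use True in auto)
next
  case False
  then have "dominable (grid False n True m) (n * m div 4)"
    using assms dominable_cycles by (auto simp: exceptional_def)
  then show ?thesis by (rule dominable_cycle) (use assms(2) False in auto)
qed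

section \<open>Throttling numbers\<close>

lemma power_dominating_set_rounds:
  assumes G: "simple_graph G" and S: "power_dominating_set G S"
  obtains t where "t \<ge> 1" "pd_closure G S t = verts G" "th_pd_set G S = enat (card S * t)"
proof -
  let ?Q = "\<lambda>t. t > 0 \<and> pd_closure G S t = verts G"
  obtain s where s: "pd_closure G S s = verts G" "S \<subseteq> verts G"
    using S by (auto simp: power_dominating_set_def)
  have "\<exists>t. ?Q t"
  \<comment> \<open>Zero rounds suffice only for the whole vertex set; since propagation time starts
    at 1, one idle round is then added.\<close>
  proof (cases "s = 0")
    case True
    then have "S = verts G" using s(1) by simp
    then have "pd_closure G S (Suc 0) = verts G"
      using closed_nbhd_subset[OF G s(2)] by (auto simp: closed_nbhd_def)
    then show ?thesis by blast
  qed (use s in blast)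
  then have "?Q (LEAST t. ?Q t)" by (rule LeastI_ex)
  moreover have "th_pd_set G S = enat (card S * (LEAST t. ?Q t))"
    using S by (simp add: th_pd_set_def power_propagation_time_def)
  ultimately show thesis using that[of "LEAST t. ?Q t"] by simp
qed

text \<open>Nonemptiness matters because \<open>0 * \<infinity> = 0\<close> in
  \<open>enat\<close>.\<close>

lemma th_pd_set_infinite:
  assumes "finite S" "S \<noteq> {}" "\<not> power_dominating_set G S"
  shows "th_pd_set G S = \<infinity>"
  using assms by (simp add: th_pd_set_def power_propagation_time_def card_gt_0_iff enat_0_iff)

lemma th_pd_set_dominating:
  assumes "dominating_set G D" "verts G \<noteq> {}"
  shows "D \<noteq> {}" "D \<subseteq> verts G" "th_pd_set G D = enat (card D)"
proof -
  show D: "D \<noteq> {}" "D \<subseteq> verts G" using assms by (auto simp: dominating_set_def closed_nbhd_def)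
  have "pd_closure G D (Suc 0) = verts G" using assms by (simp add: dominating_set_def)
  then have "power_dominating_set G D" using D unfolding power_dominating_set_def by blast
  moreover have "(LEAST t. t > 0 \<and> pd_closure G D t = verts G) = 1"
    using \<open>pd_closure G D (Suc 0) = verts G\<close> by (intro Least_equality) auto
  ultimately show "th_pd_set G D = enat (card D)"
    by (simp add: th_pd_set_def power_propagation_time_def)
qed

lemma finite_dominating_sets:
  assumes "finite (verts G)" shows "finite {S. dominating_set G S}"
  by (rule finite_subset[of _ "Pow (verts G)"]) (use assms in \<open>auto simp: dominating_set_def\<close>)

lemma domination_number_le:
  assumes "finite (verts G)" "dominable G k"
  shows "domination_number G \<le> k"
proof -
  obtain D where "dominating_set G D" "card D \<le> k" using assms(2) by (auto simp: dominable_def)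
  moreover have "domination_number G \<le> card D"
    unfolding domination_number_def using finite_dominating_sets[OF assms(1)] calculation(1)
    by (intro Min_le) auto
  ultimately show ?thesis by simp
qed

text \<open>A run of one round is domination at cost \<open>card S\<close>. So it suffices that
  every longer run costs at least the size of some dominating set.\<close>

lemma th_pd_eq_domination_number:
  assumes G: "simple_graph G" and ne: "verts G \<noteq> {}"
    and bound: "\<And>S t. \<lbrakk>S \<subseteq> verts G; t \<ge> 2; pd_closure G S t = verts G\<rbrakk> \<Longrightarrow> dominable G (card S * t)"
  shows "th_pd G = enat (domination_number G)"
proof -
  note fin = finite_verts[OF G]
  have "dominating_set G (verts G)"
    using closed_nbhd_subset[OF G] by (auto simp: dominating_set_def closed_nbhd_def)
  then have "domination_number G \<in> card ` {S. dominating_set G S}"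
    unfolding domination_number_def using finite_dominating_sets[OF fin] by (intro Min_in) auto
  then obtain D where D: "dominating_set G D" "card D = domination_number G" by auto
  have "enat (domination_number G) \<le> th_pd_set G S" if S: "S \<noteq> {}" "S \<subseteq> verts G" for S
  proof (cases "power_dominating_set G S")
    case True
    then obtain t where t: "t \<ge> 1" "pd_closure G S t = verts G" "th_pd_set G S = enat (card S * t)"
      using power_dominating_set_rounds[OF G] by blast
    have "dominable G (card S * t)"
    proof (cases "t = 1")
      case True
      then have "dominating_set G S" using t(2) S(2) by (simp add: dominating_set_def)
      then show ?thesis using True by (auto simp: dominable_def)
    next
      case False
      then show ?thesis using bound[OF S(2) _ t(2)] t(1) by simp
    qed
    then show ?thesis using domination_number_le[OF fin] t(3) by simp
  next
    case False
    then show ?thesis using th_pd_set_infinite S fin finite_subset by (metis enat_ord_code(3))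
  qed
  moreover have "enat (domination_number G) \<in> th_pd_set G ` {S. S \<noteq> {} \<and> S \<subseteq> verts G}"
    using th_pd_set_dominating[OF D(1) ne] D(2) by (metis (mono_tags) imageI mem_Collect_eq)
  ultimately show ?thesis
    unfolding th_pd_def using fin by (intro Min_eqI) auto
qed

section \<open>Products of paths and cycles\<close>

lemma chain_product_chain_graph:
  "n \<ge> 4 \<Longrightarrow> m \<ge> 4 \<Longrightarrow> chain_product (chain_graph c n) (chain_graph c' m)"
  by unfold_locales (auto intro: simple_chain_graph card_nbhd_chain_graph)

lemma card_verts_grid: "card (verts (grid c n c' m)) = n * m"
  by (simp add: verts_grid)

lemma grid_lower_bound:
  assumes "n \<ge> 4" "m \<ge> 4" and S: "S \<subseteq> verts (grid c n c' m)" "t \<ge> 2"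
    "pd_closure (grid c n c' m) S t = verts (grid c n c' m)"
  shows "n * m \<le> 4 * (card S * t)"
  using chain_product.card_closure_le(1)[OF chain_product_chain_graph[OF assms(1,2)], of S c c' t]
    S card_verts_grid[of c n c' m] by (simp add: grid_def)

text \<open>Two paths are covered by \<open>not_tight_ends\<close>. For the path on 4 vertices times
  the cycle on 5 or 9, equality gives \<open>card S * t = m\<close> with \<open>m\<close> odd, hence
  \<open>t \<ge> 3\<close>, and \<open>tight_dvd\<close> clashes with the small size of
  \<open>S\<close>.\<close>

lemma grid_not_tight:
  assumes nm: "n \<ge> 4" "m \<ge> 4" and S: "S \<subseteq> verts (grid False n c' m)" "t \<ge> 2"
    "pd_closure (grid False n c' m) S t = verts (grid False n c' m)"
    and c: "\<not> c' \<or> n = 4 \<and> (m = 5 \<or> m = 9)"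
  shows "n * m \<noteq> 4 * (card S * t)"
proof
  assume eq: "n * m = 4 * (card S * t)"
  interpret chain_product "chain_graph False n" "chain_graph c' m"
    using nm by (rule chain_product_chain_graph)
  have T: "tight S t" using S eq card_verts_grid[of False n c' m] by (simp add: tight_def grid_def)
  note conn = connected_chain_graph[of False n] connected_chain_graph[of c' m]
  have a: "nbhd (chain_graph False n) 0 = {1}" using nm by (intro nbhd_path_end) simp
  show False
  proof (cases c')
    case False
    then have "nbhd (chain_graph c' m) 0 = {1}" using nbhd_path_end[of m] nm by simp
    then show False using not_tight_ends[OF conn a] T by blast
  next
    case True
    then have m: "n = 4" "m = 5 \<or> m = 9" using c by auto
    then have St: "card S * t = m" using eq by simp
    have "t \<noteq> 2"
    proof
      assume "t = 2"
      then have "even m" using St by auto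
      then show False using m by auto
    qed
    then have "t \<ge> 3" using S(2) by simp
    then have dvd: "m dvd 8 * card S"
      using tight_dvd[OF T _ conn a] by (simp add: verts_chain_graph)
    \<comment> \<open>The odd divisor \<open>m\<close> of \<open>8 * card S\<close> would divide
      \<open>card S\<close>, which is positive and at most a third of \<open>m\<close>.\<close>
    have "card S * 3 \<le> m" using St \<open>t \<ge> 3\<close> by (metis mult_le_mono2)
    moreover have "card S \<noteq> 0" using St m by (cases "card S = 0") auto
    ultimately have "card S \<in> {1, 2, 3}" using m by auto
    then show False using dvd m(2) by auto
  qed
qed

text \<open>Either a cycle factor allows \<open>n * m div 4\<close> dominating vertices, or equality
  is impossible and the integer \<open>card S * t\<close> is larger by at least 1, which pays for
  the extra vertex.\<close>

lemma dominable_exceptional: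
  assumes nm: "(n, m) \<in> exceptional" and S: "S \<subseteq> verts (grid c n c' m)" "t \<ge> 2"
    "pd_closure (grid c n c' m) S t = verts (grid c n c' m)"
  shows "dominable (grid c n c' m) (card S * t)"
proof -
  have ge: "n \<ge> 4" "m \<ge> 4" using nm by (auto simp: exceptional_def)
  note le = grid_lower_bound[OF ge S]
  show ?thesis
  proof (cases "(c \<or> c') \<and> \<not> (\<not> c \<and> n = 4 \<and> (m = 5 \<or> m = 9))")
    case True
    then have "dominable (grid c n c' m) (n * m div 4)"
      using exceptional_cycle[OF nm] by blast
    then show ?thesis by (rule dominable_mono) (use le in simp)
  next
    case False
    then have "n * m \<noteq> 4 * (card S * t)"
      using grid_not_tight[OF ge, of S c' t] S by (cases c) auto
    then have "n * m div 4 + 1 \<le> card S * t" using le by simp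
    moreover have "dominable (grid c n c' m) (n * m div 4 + 1)"
      using dominable_cycle[OF exceptional_le(2)[OF nm]] by simp
    ultimately show ?thesis by (rule dominable_mono[rotated])
  qed
qed

lemma dominable_rounds:
  assumes ge: "n \<ge> 4" "m \<ge> 4" and S: "S \<subseteq> verts (grid c n c' m)" "t \<ge> 2"
    "pd_closure (grid c n c' m) S t = verts (grid c n c' m)"
  shows "dominable (grid c n c' m) (card S * t)"
proof -
  consider "(n, m) \<in> exceptional" | "(m, n) \<in> exceptional"
    | "(n, m) \<notin> exceptional" "(m, n) \<notin> exceptional" by blast
  then show ?thesis
  proof cases
    case 1
    then show ?thesis using S by (rule dominable_exceptional)
  next
    case 2
    have v: "verts (grid c' m c n) = prod.swap ` verts (grid c n c' m)"
      unfolding grid_def by (rule verts_swap)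
    have "pd_closure (grid c' m c n) (prod.swap ` S) t = verts (grid c' m c n)"
      using S(3) v pd_closure_swap unfolding grid_def by metis
    moreover have "prod.swap ` S \<subseteq> verts (grid c' m c n)" using S(1) v by blast
    ultimately have "dominable (grid c' m c n) (card (prod.swap ` S) * t)"
      using dominable_exceptional[OF 2 _ S(2)] by blast
    then show ?thesis using dominable_swap by (simp add: card_swap)
  next
    case 3
    then have "dominable (grid c n c' m) ((n * m + 3) div 4)"
      using dominable_cycle[OF dominable_quarter[OF ge 3]] by simp
    then show ?thesis by (rule dominable_mono) (use grid_lower_bound[OF ge S] in simp)
  qed
qed

theorem theorem6p11:
  fixes n m :: nat and J J' :: "nat graph"
  assumes "n \<ge> 4" and "m \<ge> 4"
    and "J = path_graph n \<or> J = cycle_graph n"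
    and "J' = path_graph m \<or> J' = cycle_graph m"
  shows "(\<forall>S. power_dominating_set (J \<box> J') S \<and> \<not> dominating_set (J \<box> J') S \<longrightarrow>
            th_pd_set (J \<box> J') S \<ge> enat (nat \<lceil>real (n * m) / 4\<rceil>))
       \<and> th_pd (J \<box> J') = enat (domination_number (J \<box> J'))"
proof -
  have "\<exists>c. J = chain_graph c n" "\<exists>c. J' = chain_graph c m"
    using assms(3,4) unfolding chain_graph_def by metis+
  then obtain c c' where G: "J \<box> J' = grid c n c' m" by (auto simp: grid_def)
  have simple: "simple_graph (grid c n c' m)"
    unfolding grid_def by (rule chain_product.simple_prod[OF chain_product_chain_graph[OF assms(1,2)]])
  have "verts (grid c n c' m) \<noteq> {}"
    using assms(1,2) by (simp add: verts_grid lessThan_empty_iff)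
  then have "th_pd (grid c n c' m) = enat (domination_number (grid c n c' m))"
    using simple dominable_rounds[OF assms(1,2)] by (intro th_pd_eq_domination_number)
  moreover have "th_pd_set (grid c n c' m) S \<ge> enat (nat \<lceil>real (n * m) / 4\<rceil>)"
    if S: "power_dominating_set (grid c n c' m) S" "\<not> dominating_set (grid c n c' m) S" for S
  proof -
    obtain t where t: "t \<ge> 1" "pd_closure (grid c n c' m) S t = verts (grid c n c' m)"
        "th_pd_set (grid c n c' m) S = enat (card S * t)"
      using power_dominating_set_rounds[OF simple S(1)] by blast
    have sub: "S \<subseteq> verts (grid c n c' m)" using S(1) by (simp add: power_dominating_set_def)
    have "t \<noteq> 1" using S(2) sub t(2) by (auto simp: dominating_set_def)
    then have "n * m \<le> 4 * (card S * t)"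
      using grid_lower_bound[OF assms(1,2) sub _ t(2)] t(1) by simp
    then have "real (n * m) \<le> real (4 * (card S * t))" by (rule of_nat_mono)
    then have "\<lceil>real (n * m) / 4\<rceil> \<le> int (card S * t)" by (simp add: ceiling_le_iff)
    then show ?thesis using t(3) by (simp add: nat_le_iff)
  qed
  ultimately show ?thesis unfolding G by blast
qed

end
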